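(* Let $n\ge 1$ be an integer. For every log-concave integrable function $f:\mathbb{R}^n\to[0,\infty)$ with $\int_{\mathbb{R}^n} f(x)\,dx>0$ and center of mass at the origin, i.e. $\int_{\mathbb{R}^n} x f(x)\,dx=0$, and for every unit vector $\theta\in S^{n-1}$, one has $$\int_0^{\infty} f(s\theta)\,ds\ \ge\ e^{-n}\int_{-\infty}^{\infty} f(s\theta)\,ds .$$ Moreover, the constant $e^{-n}$ is the best possible: for every real $a>e^{-n}$ there exist such a function $f$ and a unit vector $\theta\in S^{n-1}$ for which $\int_0^{\infty} f(s\theta)\,ds< a\int_{-\infty}^{\infty} f(s\theta)\,ds$.
   Context: A function $f:\mathbb{R}^n\to[0,\infty)$ is log-concave if $f((1-\lambda)x+\lambda y)\ge f(x)^{1-\lambda}f(y)^{\lambda}$ for all $x,y\in\mathbb{R}^n$ and $\lambda\in(0,1)$; in particular $f$ may vanish on part of the space. $S^{n-1}$ denotes the Euclidean unit sphere in $\mathbb{R}^n$. Integrals are with respect to Lebesgue measure (on $\mathbb{R}^n$ or on $\mathbb{R}$). *)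

theory Defs
  imports "HOL-Analysis.Analysis"
begin

text \<open>Nonnegativity is part of the definition. Since \<open>0 powr a = 0\<close>, the left-hand side vanishes
  as soon as \<open>f x = 0\<close> or \<open>f y = 0\<close>, so functions vanishing on part of the space are covered.\<close>

definition log_concave :: "('a::real_vector \<Rightarrow> real) \<Rightarrow> bool" where
  "log_concave f \<longleftrightarrow>
    (\<forall>x. 0 \<le> f x) \<and>
    (\<forall>x y. \<forall>l\<in>{0<..<1}. f x powr (1 - l) * f y powr l \<le> f ((1 - l) *\<^sub>R x + l *\<^sub>R y))"

text \<open>Completed Lebesgue measure is used because a log-concave function on \<open>\<real>\<^sup>n\<close> with \<open>n \<ge> 2\<close> need
  not be Borel measurable. Stating the barycentre condition with \<^const>\<open>has_bochner_integral\<close>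
  excludes the default value 0 of the integral of a non-integrable function; such
  integrability in fact follows from the other three conditions.\<close>

definition centered_log_concave :: "('a::euclidean_space \<Rightarrow> real) \<Rightarrow> bool" where
  "centered_log_concave f \<longleftrightarrow>
    log_concave f \<and>
    integrable lebesgue f \<and>
    0 < (\<integral>x. f x \<partial>lebesgue) \<and>
    has_bochner_integral lebesgue (\<lambda>x. f x *\<^sub>R x) 0"

end

theory Submission
  imports Defs
begin

text \<open>
  Let \<open>G x\<close> and \<open>M x\<close> be the masses of \<open>f\<close> on the ray \<open>{x + s \<theta> | s \<ge> 0}\<close> and on the whole line
  \<open>x + \<real> \<theta>\<close>. By the one-dimensional Prekopa-Leindler inequality both are log-concave in \<open>x\<close>. Fix
  \<open>0 < e < 1\<close> and put \<open>l = 1 - e\<close>; the integral of \<open>f * G powr (- e)\<close> over the space is estimated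
  twice.

  From below: on the support, \<open>G powr (- e)\<close> is the exponential of a convex function, and the
  barycentre of \<open>f\<close> is the origin, so by Jensen's inequality the integral is at least
  \<open>G 0 powr (- e)\<close> times the total mass (\<open>ray_mass_powr_le_nn_integral\<close>).

  From above: along each line \<open>f\<close> is minus the derivative of \<open>G\<close>, so the integral of
  \<open>f * G powr (- e)\<close> over the line through \<open>x\<close> is at most \<open>M x powr l / l\<close>
  (\<open>nn_integral_tail_powr_le\<close>). By log-concavity, \<open>M x powr l \<le> M 0 powr (- e) * M (l x)\<close>, and
  integrating \<open>M (l x)\<close> over the \<open>n - 1\<close> dimensions transverse to \<open>\<theta>\<close> gives \<open>1 / l ^ (n - 1)\<close> times
  the total mass. So the integral is at most \<open>M 0 powr (- e) / l ^ n\<close> times the total mass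
  (\<open>nn_integral_ray_mass_powr_le\<close>).

  Together, \<open>(M 0 / G 0) powr e \<le> 1 / (1 - e) ^ n\<close>, and \<open>e \<rightarrow> 0\<close> yields \<open>M 0 \<le> exp n * G 0\<close>.

  The integration transverse to \<open>\<theta>\<close> is expressed without choosing coordinates, by weighting the
  space with an integrable function of \<open>x \<bullet> \<theta>\<close> (\<open>nn_integral_line_average\<close>). A general \<open>f\<close> is only
  Lebesgue measurable; restricting it to the interior of its support, which contains the barycentre
  and omits only a null set, gives a Borel function that is continuous where it is positive.

  The constant is attained: for independent exponential variables shifted to have mean zero, whose
  density is proportional to \<open>exp (- (x\<^sub>1 + \<dots> + x\<^sub>n))\<close> on the orthant \<open>x\<^sub>i \<ge> - 1\<close>, the diagonal direction gives equality.
\<close>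

section \<open>The Prekopa-Leindler inequality on the real line\<close>

lemma lborel_inner_regular:
  fixes A :: "'a::euclidean_space set"
  assumes [measurable]: "A \<in> sets borel"
  shows "emeasure lborel A = (SUP K\<in>{K. K \<subseteq> A \<and> compact K}. emeasure lborel K)"
proof (rule antisym)
  let ?S = "SUP K\<in>{K. K \<subseteq> A \<and> compact K}. emeasure lborel K"
  have part: "emeasure lborel (A \<inter> cball 0 (real n)) \<le> ?S" for n :: nat
  proof -
    let ?N = "density lborel (indicator (cball (0::'a) (real n)))"
    have N: "emeasure ?N X = emeasure lborel (X \<inter> cball 0 (real n))" if "X \<in> sets borel" for X
      using that by (subst emeasure_density)
        (auto simp: Int_commute simp flip: indicator_inter_arith intro!: borel_measurable_indicator)
    have fin: "emeasure lborel (cball (0::'a) (real n)) < \<infinity>"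
      by (intro emeasure_bounded_finite) auto
    have "emeasure ?N A = (SUP K\<in>{K. K \<subseteq> A \<and> compact K}. emeasure ?N K)"
      using fin by (intro inner_regular) (auto simp: N)
    also have "\<dots> \<le> ?S"
    proof (rule SUP_least)
      fix K assume K: "K \<in> {K. K \<subseteq> A \<and> compact K}"
      then have "K \<inter> cball 0 (real n) \<in> {K. K \<subseteq> A \<and> compact K}" by (auto intro: compact_Int)
      then have "emeasure lborel (K \<inter> cball 0 (real n)) \<le> ?S" by (rule SUP_upper)
      then show "emeasure ?N K \<le> ?S" using K by (simp add: N compact_imp_closed borel_closed)
    qed
    finally show ?thesis by (simp add: N)
  qed
  have "(SUP n::nat. emeasure lborel (A \<inter> cball 0 (real n))) = emeasure lborel (\<Union>n::nat. A \<inter> cball 0 (real n))"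
    by (rule SUP_emeasure_incseq) (auto simp: incseq_def)
  also have "(\<Union>n::nat. A \<inter> cball 0 (real n)) = A"
    by (auto simp: real_arch_simple)
  finally show "emeasure lborel A \<le> ?S" using part by (metis (mono_tags, lifting) SUP_least)
  show "?S \<le> emeasure lborel A" by (auto intro!: SUP_least emeasure_mono)
qed

lemma emeasure_real_affine_image:
  fixes K :: "real set"
  assumes "compact K" "c > 0"
  shows "emeasure lborel ((\<lambda>x. t + c * x) ` K) = ennreal c * emeasure lborel K"
proof -
  have cp: "compact ((\<lambda>x. t + c * x) ` K)"
    using assms by (intro compact_continuous_image continuous_intros)
  have K[measurable]: "K \<in> sets borel" "(\<lambda>x. t + c * x) ` K \<in> sets borel"
    using assms cp by (auto simp: compact_imp_closed borel_closed)
  have "emeasure lborel ((\<lambda>x. t + c * x) ` K) = (\<integral>\<^sup>+x. indicator ((\<lambda>x. t + c * x) ` K) x \<partial>lborel)"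
    by simp
  also have "\<dots> = \<bar>c\<bar> * (\<integral>\<^sup>+x. indicator ((\<lambda>x. t + c * x) ` K) (t + c * x) \<partial>lborel)"
    using assms by (intro nn_integral_real_affine) auto
  also have "(\<lambda>x. indicator ((\<lambda>x. t + c * x) ` K) (t + c * x) :: ennreal) = indicator K"
    using assms by (auto simp: indicator_def fun_eq_iff)
  finally show ?thesis using assms by simp
qed

text \<open>The translates of \<open>(1 - l) A\<close> by the least point of \<open>l B\<close> and of \<open>l B\<close> by
  the greatest point of \<open>(1 - l) A\<close> both lie in \<open>C\<close> and share at most one point.\<close>

lemma brunn_minkowski_real_compact:
  fixes A B C :: "real set"
  assumes A: "compact A" "A \<noteq> {}" and B: "compact B" "B \<noteq> {}"
    and C: "C \<in> sets borel" and l: "0 < l" "l < 1"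
    and sub: "\<And>x y. x \<in> A \<Longrightarrow> y \<in> B \<Longrightarrow> (1 - l) * x + l * y \<in> C"
  shows "ennreal (1 - l) * emeasure lborel A + ennreal l * emeasure lborel B \<le> emeasure lborel C"
proof -
  obtain a where a: "a \<in> A" "\<And>x. x \<in> A \<Longrightarrow> x \<le> a" using compact_attains_sup[OF A] by blast
  obtain b where b: "b \<in> B" "\<And>x. x \<in> B \<Longrightarrow> b \<le> x" using compact_attains_inf[OF B] by blast
  let ?A = "(\<lambda>x. l * b + (1 - l) * x) ` A" and ?B = "(\<lambda>y. (1 - l) * a + l * y) ` B"
  have cp: "compact ?A" "compact ?B"
    using A B by (intro compact_continuous_image continuous_intros; simp)+
  have meas: "?A \<in> sets lborel" "?B \<in> sets lborel"
    using cp by (auto simp: compact_imp_closed borel_closed)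
  have int: "?A \<inter> ?B \<subseteq> {l * b + (1 - l) * a}"
  proof
    fix z assume "z \<in> ?A \<inter> ?B"
    then obtain x y where x: "x \<in> A" "z = l * b + (1 - l) * x" and y: "y \<in> B" "z = (1 - l) * a + l * y"
      by (elim IntE imageE)
    have "z \<le> l * b + (1 - l) * a" using a(2)[OF x(1)] x l by (simp add: mult_left_mono)
    moreover have "z \<ge> l * b + (1 - l) * a" using b(2)[OF y(1)] y l by (simp add: mult_left_mono)
    ultimately show "z \<in> {l * b + (1 - l) * a}" by simp
  qed
  have null: "?A \<inter> ?B \<in> null_sets lborel"
    by (rule null_sets_subset[OF _ _ int]) (use meas in auto)
  have "ennreal (1 - l) * emeasure lborel A + ennreal l * emeasure lborel B
      = emeasure lborel ?A + emeasure lborel ?B"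
    using A B l by (simp add: emeasure_real_affine_image)
  also have "\<dots> = emeasure lborel (?A \<union> ?B)"
  proof -
    have "emeasure lborel ?B = emeasure lborel (?B - ?A \<inter> ?B)"
      using emeasure_Diff_null_set[OF null meas(2)] by simp
    also have "?B - ?A \<inter> ?B = ?B - ?A" by blast
    finally have "emeasure lborel ?A + emeasure lborel ?B = emeasure lborel ?A + emeasure lborel (?B - ?A)" by simp
    also have "\<dots> = emeasure lborel (?A \<union> (?B - ?A))"
      using meas by (intro plus_emeasure) auto
    finally show ?thesis by simp
  qed
  also have "\<dots> \<le> emeasure lborel C"
    using sub a b C by (intro emeasure_mono) (auto simp: add.commute)
  finally show ?thesis .
qed

lemma brunn_minkowski_real:
  fixes A B C :: "real set"
  assumes A: "A \<in> sets borel" "A \<noteq> {}" and B: "B \<in> sets borel" "B \<noteq> {}"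
    and C: "C \<in> sets borel" and l: "0 < l" "l < 1"
    and sub: "\<And>x y. x \<in> A \<Longrightarrow> y \<in> B \<Longrightarrow> (1 - l) * x + l * y \<in> C"
  shows "ennreal (1 - l) * emeasure lborel A + ennreal l * emeasure lborel B \<le> emeasure lborel C"
proof -
  have cpt: "ennreal (1 - l) * emeasure lborel K + ennreal l * emeasure lborel L \<le> emeasure lborel C"
    if KL: "K \<subseteq> A" "compact K" "L \<subseteq> B" "compact L" for K L
  proof -
    obtain a b where ab: "a \<in> A" "b \<in> B" using A B by blast
    have "ennreal (1 - l) * emeasure lborel (insert a K) + ennreal l * emeasure lborel (insert b L)
        \<le> emeasure lborel C"
      by (rule brunn_minkowski_real_compact) (use KL ab C l sub in \<open>auto intro: compact_insert\<close>)
    moreover have "emeasure lborel K \<le> emeasure lborel (insert a K)"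
        "emeasure lborel L \<le> emeasure lborel (insert b L)"
      using KL by (auto intro!: emeasure_mono simp: compact_imp_closed borel_closed closed_insert)
    ultimately show ?thesis
      by (meson add_mono mult_left_mono order_trans zero_le)
  qed
  have ne: "{K. K \<subseteq> A \<and> compact K} \<noteq> {}" "{K. K \<subseteq> B \<and> compact K} \<noteq> {}" by auto
  have 1: "ennreal (1 - l) * emeasure lborel A + ennreal l * emeasure lborel L \<le> emeasure lborel C"
    if L: "L \<subseteq> B" "compact L" for L
    using ne(1) cpt L by (subst lborel_inner_regular[OF A(1)])
      (simp add: SUP_mult_left_ennreal ennreal_SUP_add_left[symmetric] SUP_le_iff)
  show ?thesis
    using ne(2) 1 by (subst lborel_inner_regular[OF B(1)])
      (simp add: SUP_mult_left_ennreal ennreal_SUP_add_right SUP_le_iff)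
qed

lemma nn_integral_layer_cake:
  fixes w :: "'a \<Rightarrow> real"
  assumes "sigma_finite_measure M" and [measurable]: "w \<in> borel_measurable M"
  shows "(\<integral>\<^sup>+x. ennreal (w x) \<partial>M) = (\<integral>\<^sup>+t\<in>{0..}. emeasure M {x\<in>space M. t < w x} \<partial>lborel)"
proof -
  interpret sigma_finite_measure M by fact
  interpret pair_sigma_finite M "lborel :: real measure" ..
  have "(\<integral>\<^sup>+x. ennreal (w x) \<partial>M) = (\<integral>\<^sup>+x. (\<integral>\<^sup>+t. indicator {t. 0 \<le> t \<and> t < w x} t \<partial>lborel) \<partial>M)"
  proof (intro nn_integral_cong)
    fix x
    have "{t. 0 \<le> t \<and> t < w x} = {0..<w x}" by auto
    then show "ennreal (w x) = (\<integral>\<^sup>+t. indicator {t. 0 \<le> t \<and> t < w x} t \<partial>lborel)"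
      by (cases "0 \<le> w x") (auto simp: ennreal_neg)
  qed
  also have "\<dots> = (\<integral>\<^sup>+t. (\<integral>\<^sup>+x. indicator {t. 0 \<le> t \<and> t < w x} t \<partial>M) \<partial>lborel)"
    by (rule Fubini'[symmetric]) measurable
  also have "\<dots> = (\<integral>\<^sup>+t\<in>{0..}. emeasure M {x\<in>space M. t < w x} \<partial>lborel)"
  proof (intro nn_integral_cong)
    fix t :: real
    have "(\<integral>\<^sup>+x. indicator {t. 0 \<le> t \<and> t < w x} t \<partial>M)
        = (\<integral>\<^sup>+x. indicator {0..} t * indicator {x\<in>space M. t < w x} x \<partial>M)"
      by (intro nn_integral_cong) (auto simp: indicator_def)
    also have "\<dots> = indicator {0..} t * emeasure M {x\<in>space M. t < w x}"
      by (subst nn_integral_cmult_indicator) auto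
    finally show "(\<integral>\<^sup>+x. indicator {t. 0 \<le> t \<and> t < w x} t \<partial>M) = emeasure M {x\<in>space M. t < w x} * indicator {0..} t"
      by (simp add: mult.commute)
  qed
  finally show ?thesis .
qed

text \<open>When both suprema are \<open>1\<close>, all superlevel sets at heights in \<open>{0..<1}\<close> are nonempty, and the
  one-dimensional Brunn-Minkowski inequality applies at each height.\<close>

lemma prekopa_leindler_real_normalized:
  fixes u v w :: "real \<Rightarrow> real"
  assumes [measurable]: "u \<in> borel_measurable borel" "v \<in> borel_measurable borel" "w \<in> borel_measurable borel"
    and le1: "\<And>x. u x \<le> 1" "\<And>x. v x \<le> 1"
    and sup: "\<And>t. t < 1 \<Longrightarrow> \<exists>x. t < u x" "\<And>t. t < 1 \<Longrightarrow> \<exists>x. t < v x"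
    and l: "0 < l" "l < 1"
    and w: "\<And>x y. min (u x) (v y) \<le> w ((1 - l) * x + l * y)"
  shows "ennreal (1 - l) * (\<integral>\<^sup>+x. u x \<partial>lborel) + ennreal l * (\<integral>\<^sup>+x. v x \<partial>lborel) \<le> (\<integral>\<^sup>+x. w x \<partial>lborel)"
proof -
  have sf: "sigma_finite_measure (lborel :: real measure)" ..
  have [measurable]: "(\<lambda>t. emeasure lborel {x \<in> space lborel. t < g x}) \<in> borel_measurable borel"
    if [measurable]: "g \<in> borel_measurable borel" for g :: "real \<Rightarrow> real"
  proof -
    have "(\<lambda>t. emeasure lborel {x \<in> space lborel. t < g x}) = (\<lambda>t. \<integral>\<^sup>+x. indicator {x. t < g x} x \<partial>lborel)"
      by (simp add: fun_eq_iff)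
    also have "\<dots> \<in> borel_measurable borel" by measurable
    finally show ?thesis .
  qed
  let ?e = "\<lambda>g t. emeasure lborel {x \<in> space lborel. t < (g x :: real)}"
  have "ennreal (1 - l) * (\<integral>\<^sup>+x. u x \<partial>lborel) + ennreal l * (\<integral>\<^sup>+x. v x \<partial>lborel)
     = (\<integral>\<^sup>+t. ennreal (1 - l) * (?e u t * indicator {0..} t) + ennreal l * (?e v t * indicator {0..} t) \<partial>lborel)"
    by (subst nn_integral_add) (auto simp: nn_integral_cmult nn_integral_layer_cake[OF sf])
  also have "\<dots> \<le> (\<integral>\<^sup>+t. ?e w t * indicator {0..} t \<partial>lborel)"
  proof (rule nn_integral_mono)
    fix t :: real
    show "ennreal (1 - l) * (?e u t * indicator {0..} t) + ennreal l * (?e v t * indicator {0..} t)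
        \<le> ?e w t * indicator {0..} t"
    proof (cases "0 \<le> t \<and> t < 1")
      case True
      have "ennreal (1 - l) * ?e u t + ennreal l * ?e v t \<le> ?e w t"
      proof (rule brunn_minkowski_real[OF _ _ _ _ _ l])
        fix x y assume "x \<in> {x \<in> space lborel. t < u x}" "y \<in> {x \<in> space lborel. t < v x}"
        then show "(1 - l) * x + l * y \<in> {x \<in> space lborel. t < w x}"
          using w[of x y] by auto
      qed (use sup True in auto)
      then show ?thesis using True by simp
    next
      case False
      then have "t < 0 \<or> (?e u t = 0 \<and> ?e v t = 0)"
        using le1 by (auto simp: not_less not_le) (metis (no_types, lifting) Collect_empty_eq emeasure_empty le1 not_less order.trans)+
      then show ?thesis by auto
    qed
  qed
  also have "\<dots> = (\<integral>\<^sup>+x. w x \<partial>lborel)"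
    by (simp add: nn_integral_layer_cake[OF sf])
  finally show ?thesis .
qed

text \<open>Dividing by the suprema reduces to normalized functions; the weighted arithmetic mean that
  then appears dominates the geometric one.\<close>

lemma prekopa_leindler_real:
  fixes u v w :: "real \<Rightarrow> real"
  assumes int: "integrable lborel u" "integrable lborel v" "integrable lborel w"
    and nonneg: "\<And>x. 0 \<le> u x" "\<And>x. 0 \<le> v x" "\<And>x. 0 \<le> w x"
    and bdd: "bdd_above (range u)" "bdd_above (range v)"
    and l: "0 < l" "l < 1"
    and w: "\<And>x y. u x powr (1 - l) * v y powr l \<le> w ((1 - l) * x + l * y)"
  shows "(\<integral>x. u x \<partial>lborel) powr (1 - l) * (\<integral>x. v x \<partial>lborel) powr l \<le> (\<integral>x. w x \<partial>lborel)"
proof (cases "(\<integral>x. u x \<partial>lborel) = 0 \<or> (\<integral>x. v x \<partial>lborel) = 0")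
  case True
  then show ?thesis using nonneg l by (auto intro!: Bochner_Integration.integral_nonneg)
next
  case False
  have [measurable]: "u \<in> borel_measurable borel" "v \<in> borel_measurable borel" "w \<in> borel_measurable borel"
    using int by (auto dest: borel_measurable_integrable)
  have ex: "(\<exists>x. 0 < u x)" "(\<exists>x. 0 < v x)"
    using False nonneg by (force simp: less_le)+
  define a where "a = (SUP x. u x)"
  define b where "b = (SUP x. v x)"
  have le: "u x \<le> a" "v x \<le> b" for x
    using bdd by (auto simp: a_def b_def intro: cSUP_upper)
  have ab: "0 < a" "0 < b" using ex le by (meson less_le_trans)+
  define c where "c = a powr (1 - l) * b powr l"
  have c: "0 < c" using ab by (simp add: c_def)
  have "ennreal (1 - l) * (\<integral>\<^sup>+x. u x / a \<partial>lborel) + ennreal l * (\<integral>\<^sup>+x. v x / b \<partial>lborel)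
      \<le> (\<integral>\<^sup>+x. w x / c \<partial>lborel)"
  proof (rule prekopa_leindler_real_normalized[OF _ _ _ _ _ _ _ l])
    fix t :: real assume t: "t < 1"
    have "t * a < a" "t * b < b" using t ab by auto
    then have "\<exists>x. t * a < u x" "\<exists>x. t * b < v x"
      using bdd by (auto simp: a_def b_def less_cSUP_iff)
    then show "\<exists>x. t < u x / a" "\<exists>x. t < v x / b" using ab by (auto simp: field_simps)
  next
    fix x y
    let ?m = "min (u x / a) (v y / b)"
    have m: "0 \<le> ?m" using nonneg ab by auto
    have "?m = ?m powr (1 - l) * ?m powr l"
      using m by (cases "?m = 0") (auto simp flip: powr_add)
    also have "\<dots> \<le> (u x / a) powr (1 - l) * (v y / b) powr l"
      using m l by (intro mult_mono powr_mono2) auto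
    also have "\<dots> = u x powr (1 - l) * v y powr l / c"
      using nonneg ab by (simp add: c_def powr_divide)
    also have "\<dots> \<le> w ((1 - l) * x + l * y) / c"
      using w c by (intro divide_right_mono) auto
    finally show "?m \<le> w ((1 - l) * x + l * y) / c" .
  qed (use le ab in auto)
  moreover have "(\<integral>\<^sup>+x. u x / a \<partial>lborel) = ennreal ((\<integral>x. u x \<partial>lborel) / a)"
      "(\<integral>\<^sup>+x. v x / b \<partial>lborel) = ennreal ((\<integral>x. v x \<partial>lborel) / b)"
      "(\<integral>\<^sup>+x. w x / c \<partial>lborel) = ennreal ((\<integral>x. w x \<partial>lborel) / c)"
    using int nonneg ab c by (subst nn_integral_eq_integral; auto)+
  moreover have nn: "0 \<le> (\<integral>x. u x \<partial>lborel)" "0 \<le> (\<integral>x. v x \<partial>lborel)" "0 \<le> (\<integral>x. w x \<partial>lborel)"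
    using nonneg by (auto intro!: Bochner_Integration.integral_nonneg)
  ultimately have am: "(1 - l) * ((\<integral>x. u x \<partial>lborel) / a) + l * ((\<integral>x. v x \<partial>lborel) / b) \<le> (\<integral>x. w x \<partial>lborel) / c"
    using ab c l by (simp flip: ennreal_mult' ennreal_plus)
  define p where "p = (\<integral>x. u x \<partial>lborel) / a"
  define q where "q = (\<integral>x. v x \<partial>lborel) / b"
  have pq: "0 < p" "0 < q" using False nn ab by (auto simp: p_def q_def)
  have "p powr (1 - l) * q powr l \<le> (1 - l) * p + l * q"
    using pq l by (intro Youngs_inequality_0) auto
  also have "\<dots> \<le> (\<integral>x. w x \<partial>lborel) / c" using am by (simp add: p_def q_def)
  finally have "p powr (1 - l) * q powr l * c \<le> (\<integral>x. w x \<partial>lborel)"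
    using c by (simp add: field_simps)
  also have "p powr (1 - l) * q powr l * c = (\<integral>x. u x \<partial>lborel) powr (1 - l) * (\<integral>x. v x \<partial>lborel) powr l"
    using nn ab by (simp add: p_def q_def c_def powr_divide)
  finally show ?thesis .
qed

section \<open>Integrals along a line\<close>

lemma open_convex_real_exhaustion:
  fixes I :: "real set"
  assumes "open I" "convex I" "I \<noteq> {}"
  obtains c d :: "nat \<Rightarrow> real" where "decseq c" "incseq d" "\<And>n. c n < d n" "I = (\<Union>n. {c n..d n})"
proof -
  define a where "a = Inf (ereal ` I)"
  define b where "b = Sup (ereal ` I)"
  have lt: "\<exists>y\<in>I. y < x" "\<exists>y\<in>I. x < y" if x: "x \<in> I" for x
  proof -
    obtain e where e: "0 < e" "ball x e \<subseteq> I" by (rule openE[OF assms(1) x])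
    then have "x - e/2 \<in> ball x e" "x + e/2 \<in> ball x e" by (auto simp: dist_real_def)
    then have "x - e/2 \<in> I" "x + e/2 \<in> I" "x - e/2 < x" "x < x + e/2" using e by auto
    then show "\<exists>y\<in>I. y < x" "\<exists>y\<in>I. x < y" by blast+
  qed
  have "x \<in> einterval a b" if "x \<in> I" for x
    using lt[OF that] by (auto simp: einterval_def a_def b_def Inf_less_iff less_Sup_iff)
  moreover have "x \<in> I" if x: "x \<in> einterval a b" for x
  proof -
    obtain y z where "y \<in> I" "y < x" "z \<in> I" "x < z"
      using x by (auto simp: einterval_def a_def b_def Inf_less_iff less_Sup_iff)
    then show ?thesis
      using mem_is_interval_1_I[of I y z x] assms(2) by (simp add: is_interval_convex_1)
  qed
  ultimately have I: "I = einterval a b" by blast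
  obtain x where "x \<in> einterval a b" using assms(3) I by blast
  then have ab: "a < b" using less_trans[of a "ereal x" b] by (simp add: einterval_def)
  obtain u l :: "nat \<Rightarrow> real" where "einterval a b = (\<Union>i. {l i .. u i})"
    "incseq u" "decseq l" "\<And>i. l i < u i" by (rule einterval_Icc_approximation[OF ab]) (rule that)
  then show ?thesis using that[of l u] I by simp
qed

text \<open>Where \<open>u\<close> is positive, \<open>- U powr l / l\<close> is an antiderivative of \<open>u * U powr (l - 1)\<close>, where
  \<open>U\<close> is the tail integral.\<close>

lemma nn_integral_tail_powr_le:
  fixes u :: "real \<Rightarrow> real"
  assumes int: "integrable lborel u" and nonneg: "\<And>s. 0 \<le> u s"
    and op: "open {s. 0 < u s}" and conv: "convex {s. 0 < u s}"
    and cont: "continuous_on {s. 0 < u s} u" and l: "0 < l" "l < 1"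
  shows "(\<integral>\<^sup>+s. ennreal (u s * (LINT r:{s..}|lborel. u r) powr (l - 1)) \<partial>lborel)
    \<le> ennreal ((\<integral>s. u s \<partial>lborel) powr l / l)"
proof (cases "{s. 0 < u s} = {}")
  case True
  then have "u s = 0" for s using nonneg[of s] by (auto simp: less_le)
  then show ?thesis by simp
next
  case False
  have [measurable]: "u \<in> borel_measurable borel" using int by auto
  define U where "U s = (LINT r:{s..}|lborel. u r)" for s
  define m where "m = (\<integral>s. u s \<partial>lborel)"
  have si: "set_integrable lborel A u" if "A \<in> sets borel" for A
    using int that unfolding set_integrable_def by (intro integrable_mult_indicator) auto
  have U0: "0 \<le> U s" for s
    using nonneg by (auto simp: U_def set_lebesgue_integral_def intro!: Bochner_Integration.integral_nonneg)
  have Um: "U s \<le> m" for s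
    using nonneg int si[of "{s..}"] unfolding U_def m_def set_lebesgue_integral_def set_integrable_def
    by (intro integral_mono) (auto simp: indicator_def)
  have [measurable]: "U \<in> borel_measurable borel"
  proof -
    have "U = (\<lambda>s. \<integral>r. (if s \<le> r then u r else 0) \<partial>lborel)"
      by (auto simp: U_def set_lebesgue_integral_def fun_eq_iff indicator_def intro!: Bochner_Integration.integral_cong)
    also have "\<dots> \<in> borel_measurable borel" by measurable
    finally show ?thesis .
  qed
  obtain c d :: "nat \<Rightarrow> real" where cd: "decseq c" "incseq d" "\<And>n. c n < d n" "{s. 0 < u s} = (\<Union>n. {c n..d n})"
    by (rule open_convex_real_exhaustion[OF op conv False]) (rule that)
  have split: "U x = integral {x..z} u + U z" if "x \<le> z" for x z
  proof -
    have "{x..} = {x..z} \<union> {z..}" using that by auto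
    then have "U x = (LINT r:{x..z} \<union> {z..}|lborel. u r)" by (simp add: U_def)
    also have "\<dots> = (LINT r:{x..z}|lborel. u r) + U z"
      unfolding U_def
    proof (rule set_integral_Un_AE)
      show "AE r in lborel. \<not> (r \<in> {x..z} \<and> r \<in> {z..})"
        using AE_lborel_singleton[of z] by (rule AE_mp) auto
    qed (auto intro!: si)
    finally show ?thesis using si by (simp add: set_borel_integral_eq_integral)
  qed
  have part: "(\<integral>\<^sup>+s. ennreal (u s * U s powr (l - 1)) * indicator {c n..d n} s \<partial>lborel) \<le> ennreal (m powr l / l)" for n
  proof -
    have sub: "{c n..d n} \<subseteq> {s. 0 < u s}" using cd(4) by blast
    have "c n \<in> {s. 0 < u s}" "d n \<in> {s. 0 < u s}" using subsetD[OF sub, of "c n"] subsetD[OF sub, of "d n"] cd(3)[of n] by auto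
    then obtain c' d' where c': "c' < c n" "d n < d'" "0 < u c'" "0 < u d'"
    proof -
      obtain e1 where e1: "0 < e1" "ball (c n) e1 \<subseteq> {s. 0 < u s}"
        by (rule openE[OF op \<open>c n \<in> _\<close>])
      obtain e2 where e2: "0 < e2" "ball (d n) e2 \<subseteq> {s. 0 < u s}"
        by (rule openE[OF op \<open>d n \<in> _\<close>])
      have "c n - e1/2 \<in> ball (c n) e1" "d n + e2/2 \<in> ball (d n) e2" using e1(1) e2(1) by (auto simp: dist_real_def)
      then have "0 < u (c n - e1/2)" "0 < u (d n + e2/2)" using e1(2) e2(2) by blast+
      then show ?thesis using that[of "c n - e1/2" "d n + e2/2"] e1(1) e2(1) by simp
    qed
    have sub': "{c'..d'} \<subseteq> {s. 0 < u s}"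
      using mem_is_interval_1_I[of "{s. 0 < u s}" c' d'] conv c' by (auto simp: is_interval_convex_1)
    have cont': "continuous_on {c'..d'} u" by (rule continuous_on_subset[OF cont sub'])
    have dU: "(U has_real_derivative - u x) (at x)" if x: "c' < x" "x < d'" for x
    proof -
      have "((\<lambda>x. integral {c'..x} u) has_real_derivative u x) (at x within {c'..d'})"
        using x by (intro integral_has_real_derivative[OF cont']) auto
      then have "((\<lambda>x. integral {c'..x} u) has_real_derivative u x) (at x)"
        using x by (simp add: at_within_Icc_at)
      then have *: "((\<lambda>x. U c' - integral {c'..x} u) has_real_derivative - u x) (at x)"
        by (auto intro!: derivative_eq_intros)
      show ?thesis
        by (rule has_field_derivative_transform_within_open[OF *, of "{c'<..<d'}"]) (use x split in \<open>auto simp: algebra_simps\<close>)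
    qed
    have Upos: "0 < U x" if "c n \<le> x" "x \<le> d n" for x
    proof -
      define y where "y = (d n + d') / 2"
      have y: "x < y" "y < d'" using that c' by (auto simp: y_def)
      have "U y < U x"
      proof (rule DERIV_neg_imp_decreasing[OF y(1)])
        fix z assume z: "x \<le> z" "z \<le> y"
        then have "DERIV U z :> - u z" "0 < u z" using dU[of z] c' that y subsetD[OF sub', of z] by auto
        then show "\<exists>d. DERIV U z :> d \<and> d < 0" by (intro exI[of _ "- u z"]) auto
      qed
      then show ?thesis using U0[of y] by linarith
    qed
    have "(\<integral>\<^sup>+s. ennreal (u s * U s powr (l - 1)) * indicator {c n..d n} s \<partial>lborel)
        = ennreal (- (U (d n) powr l / l) - - (U (c n) powr l / l))"
    proof (rule nn_integral_FTC_Icc)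
      fix x assume x: "x \<in> {c n..d n}"
      then have "c' < x" "x < d'" using c' by auto
      note [derivative_intros] = DERIV_cong[OF dU[OF this]]
      show "((\<lambda>x. - (U x powr l / l)) has_real_derivative u x * U x powr (l - 1)) (at x)"
        using Upos[of x] x l
        by (auto intro!: derivative_eq_intros dU \<open>c' < x\<close> \<open>x < d'\<close> simp: powr_diff)
      show "0 \<le> u x * U x powr (l - 1)" using nonneg by auto
    qed (use cd(3)[of n] in auto)
    also have "\<dots> \<le> ennreal (m powr l / l)"
    proof (rule ennreal_leI)
      have "U (c n) powr l \<le> m powr l" using U0 Um l by (intro powr_mono2) auto
      then have "(U (c n) powr l - U (d n) powr l) / l \<le> m powr l / l"
        using l powr_ge_zero[of "U (d n)" l] by (intro divide_right_mono) linarith+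
      then show "- (U (d n) powr l / l) - - (U (c n) powr l / l) \<le> m powr l / l"
        by (simp add: diff_divide_distrib)
    qed
    finally show ?thesis .
  qed
  have inc: "incseq (\<lambda>n s. ennreal (u s * U s powr (l - 1)) * indicator {c n..d n} s)"
  proof (intro incseq_SucI le_funI mult_left_mono)
    fix n s
    have "c (Suc n) \<le> c n" "d n \<le> d (Suc n)" using cd(1,2) by (auto intro: decseq_SucD incseq_SucD)
    then show "indicator {c n..d n} s \<le> (indicator {c (Suc n)..d (Suc n)} s :: ennreal)"
      by (auto simp: indicator_def)
  qed auto
  have "(\<integral>\<^sup>+s. ennreal (u s * U s powr (l - 1)) \<partial>lborel)
      = (\<integral>\<^sup>+s. (SUP n. ennreal (u s * U s powr (l - 1)) * indicator {c n..d n} s) \<partial>lborel)"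
  proof (rule nn_integral_cong)
    fix s
    have "(SUP n. indicator {c n..d n} s :: ennreal) = 1" if us: "0 < u s"
    proof -
      obtain n where "s \<in> {c n..d n}" using cd(4) us by blast
      then have "1 \<le> (SUP n. indicator {c n..d n} s :: ennreal)" by (intro SUP_upper2[of n UNIV]) auto
      moreover have "(SUP n. indicator {c n..d n} s :: ennreal) \<le> 1" by (intro SUP_least) (auto simp: indicator_def)
      ultimately show ?thesis by (rule antisym[rotated])
    qed
    then show "ennreal (u s * U s powr (l - 1)) = (SUP n. ennreal (u s * U s powr (l - 1)) * indicator {c n..d n} s)"
      using nonneg[of s] unfolding SUP_mult_left_ennreal[symmetric] by (cases "u s = 0") (auto simp: less_le)
  qed
  also have "\<dots> = (SUP n. \<integral>\<^sup>+s. ennreal (u s * U s powr (l - 1)) * indicator {c n..d n} s \<partial>lborel)"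
    by (rule nn_integral_monotone_convergence_SUP[OF inc]) measurable
  also have "\<dots> \<le> ennreal (m powr l / l)" by (intro SUP_least part)
  finally show ?thesis by (simp add: U_def m_def)
qed

section \<open>Averaging over parallel lines\<close>

lemma nn_integral_lborel_translate:
  fixes a :: "'a::euclidean_space"
  assumes [measurable]: "f \<in> borel_measurable borel"
  shows "(\<integral>\<^sup>+x. f (a + x) \<partial>lborel) = (\<integral>\<^sup>+x. f x \<partial>lborel)"
proof -
  have "(\<integral>\<^sup>+x. f x \<partial>lborel) = (\<integral>\<^sup>+x. f x \<partial>distr lborel borel ((+) a))" by (simp add: lborel_distr_plus)
  also have "\<dots> = (\<integral>\<^sup>+x. f (a + x) \<partial>lborel)" by (subst nn_integral_distr) auto
  finally show ?thesis by simp
qed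

lemma nn_integral_lborel_scale:
  fixes f :: "'a::euclidean_space \<Rightarrow> ennreal"
  assumes [measurable]: "f \<in> borel_measurable borel" and c: "c \<noteq> 0"
  shows "(\<integral>\<^sup>+x. f x \<partial>lborel) = ennreal (\<bar>c\<bar> ^ DIM('a)) * (\<integral>\<^sup>+x. f (c *\<^sub>R x) \<partial>lborel)"
  by (subst lborel_affine[OF c, of 0])
     (simp add: nn_integral_density nn_integral_distr nn_integral_cmult)

text \<open>The inner integral is constant along \<open>\<theta>\<close>; weighting it by \<open>p (x \<bullet> \<theta>)\<close> plays the role of
  integrating it over the orthogonal complement of \<open>\<theta>\<close> in Fubini's theorem.\<close>

lemma nn_integral_line_average:
  fixes h :: "'a::euclidean_space \<Rightarrow> ennreal" and p :: "real \<Rightarrow> ennreal"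
  assumes [measurable]: "h \<in> borel_measurable borel" "p \<in> borel_measurable borel"
    and \<theta>: "norm \<theta> = 1"
  shows "(\<integral>\<^sup>+x. p (x \<bullet> \<theta>) * (\<integral>\<^sup>+s. h (x + s *\<^sub>R \<theta>) \<partial>lborel) \<partial>lborel)
    = (\<integral>\<^sup>+x. h x \<partial>lborel) * (\<integral>\<^sup>+s. p s \<partial>lborel)"
proof -
  have \<theta>\<theta>: "\<theta> \<bullet> \<theta> = 1" using \<theta> by (simp add: dot_square_norm)
  have "(\<integral>\<^sup>+x. p (x \<bullet> \<theta>) * (\<integral>\<^sup>+s. h (x + s *\<^sub>R \<theta>) \<partial>lborel) \<partial>lborel)
      = (\<integral>\<^sup>+x. \<integral>\<^sup>+s. p (x \<bullet> \<theta>) * h (x + s *\<^sub>R \<theta>) \<partial>lborel \<partial>lborel)"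
    by (simp add: nn_integral_cmult)
  also have "\<dots> = (\<integral>\<^sup>+s. \<integral>\<^sup>+x. p (x \<bullet> \<theta>) * h (x + s *\<^sub>R \<theta>) \<partial>lborel \<partial>lborel)"
    by (rule lborel_pair.Fubini'[symmetric]) measurable
  also have "\<dots> = (\<integral>\<^sup>+s. \<integral>\<^sup>+x. p (x \<bullet> \<theta> - s) * h x \<partial>lborel \<partial>lborel)"
  proof (rule nn_integral_cong)
    fix s
    show "(\<integral>\<^sup>+x. p (x \<bullet> \<theta>) * h (x + s *\<^sub>R \<theta>) \<partial>lborel) = (\<integral>\<^sup>+x. p (x \<bullet> \<theta> - s) * h x \<partial>lborel)"
      by (subst nn_integral_lborel_translate[of _ "s *\<^sub>R \<theta>", symmetric])
         (auto simp: inner_add_left \<theta>\<theta> add.commute)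
  qed
  also have "\<dots> = (\<integral>\<^sup>+x. \<integral>\<^sup>+s. p (x \<bullet> \<theta> - s) * h x \<partial>lborel \<partial>lborel)"
    by (rule lborel_pair.Fubini') measurable
  also have "\<dots> = (\<integral>\<^sup>+x. h x * (\<integral>\<^sup>+s. p s \<partial>lborel) \<partial>lborel)"
  proof (rule nn_integral_cong)
    fix x
    have "(\<integral>\<^sup>+s. p s \<partial>lborel) = ennreal \<bar>-1\<bar> * (\<integral>\<^sup>+s. p (x \<bullet> \<theta> + -1 * s) \<partial>lborel)"
      by (rule nn_integral_real_affine) auto
    then show "(\<integral>\<^sup>+s. p (x \<bullet> \<theta> - s) * h x \<partial>lborel) = h x * (\<integral>\<^sup>+s. p s \<partial>lborel)"
      by (subst nn_integral_multc) (auto simp: mult.commute)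
  qed
  finally show ?thesis by (simp add: nn_integral_multc)
qed

lemma ex_positive_integrable_weight:
  obtains p :: "real \<Rightarrow> ennreal" where "p \<in> borel_measurable borel" "\<And>t. 0 < p t"
    "(\<integral>\<^sup>+t. p t \<partial>lborel) \<noteq> \<infinity>" "(\<integral>\<^sup>+t. p t \<partial>lborel) \<noteq> 0"
proof -
  obtain p :: "real \<Rightarrow> ennreal" where p: "p \<in> borel_measurable lborel" "(\<integral>\<^sup>+t. p t \<partial>lborel) \<noteq> \<infinity>" "\<And>t. 0 < p t"
    using sigma_finite_measure.Ex_finite_integrable_function[OF sigma_finite_lborel] by auto
  have "(\<integral>\<^sup>+t. p t \<partial>lborel) \<noteq> 0"
  proof
    assume "(\<integral>\<^sup>+t. p t \<partial>lborel) = 0"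
    then have "emeasure lborel {t \<in> space lborel. p t \<noteq> 0} = 0"
      using p(1) by (simp add: nn_integral_0_iff)
    moreover have "{t \<in> space lborel. p t \<noteq> 0} = UNIV" using p(3) by (auto simp: less_le)
    ultimately show False by simp
  qed
  then show ?thesis using p that by simp
qed

section \<open>Subgradients\<close>

lemma convex_on_ex_subgradient:
  fixes \<phi> :: "'a::euclidean_space \<Rightarrow> real"
  assumes \<phi>: "convex_on K \<phi>" and x0: "x0 \<in> interior K"
  obtains q where "\<And>x. x \<in> K \<Longrightarrow> \<phi> x0 + q \<bullet> (x - x0) \<le> \<phi> x"
proof -
  have K: "convex K" using \<phi> by (rule convex_on_imp_convex)
  have x0K: "x0 \<in> K" using x0 interior_subset by blast
  define S where "S = {(x, t). x0 + x \<in> K \<and> \<phi> (x0 + x) < \<phi> x0 + t}"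
  have "convex S"
  proof (rule convexI)
    fix a b :: "'a \<times> real" and u v :: real
    assume a: "a \<in> S" and b: "b \<in> S" and uv: "0 \<le> u" "0 \<le> v" "u + v = 1"
    have "u *\<^sub>R (x0 + fst a) + v *\<^sub>R (x0 + fst b) = (u + v) *\<^sub>R x0 + (u *\<^sub>R fst a + v *\<^sub>R fst b)"
      by (simp add: algebra_simps)
    then have eq: "x0 + (u *\<^sub>R fst a + v *\<^sub>R fst b) = u *\<^sub>R (x0 + fst a) + v *\<^sub>R (x0 + fst b)"
      using uv by simp
    have "\<phi> (u *\<^sub>R (x0 + fst a) + v *\<^sub>R (x0 + fst b)) \<le> u * \<phi> (x0 + fst a) + v * \<phi> (x0 + fst b)"
      using \<phi> a b uv by (auto simp: convex_on_def S_def)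
    also have "\<dots> < u * (\<phi> x0 + snd a) + v * (\<phi> x0 + snd b)"
    proof (cases "u = 0")
      case True
      then show ?thesis using b uv by (auto simp: S_def)
    next
      case False
      have "u * \<phi> (x0 + fst a) < u * (\<phi> x0 + snd a)" using a uv False by (auto simp: S_def)
      moreover have "v * \<phi> (x0 + fst b) \<le> v * (\<phi> x0 + snd b)"
        using b uv by (intro mult_left_mono) (auto simp: S_def)
      ultimately show ?thesis by simp
    qed
    also have "\<dots> = (u + v) * \<phi> x0 + (u * snd a + v * snd b)" by (simp add: algebra_simps)
    also have "u + v = 1" by (rule uv)
    finally have "\<phi> (u *\<^sub>R (x0 + fst a) + v *\<^sub>R (x0 + fst b)) < \<phi> x0 + (u * snd a + v * snd b)"
      by simp
    moreover have "u *\<^sub>R (x0 + fst a) + v *\<^sub>R (x0 + fst b) \<in> K"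
      using K a b uv by (auto simp: S_def convex_def)
    ultimately show "u *\<^sub>R a + v *\<^sub>R b \<in> S" by (simp add: S_def eq case_prod_beta)
  qed
  moreover have "0 \<notin> S" by (simp add: S_def zero_prod_def)
  ultimately obtain ab where ab: "ab \<noteq> 0" "\<forall>x\<in>S. 0 \<le> inner ab x"
    using separating_hyperplane_set_0 by blast
  obtain a b where [simp]: "ab = (a, b)" by (cases ab)
  have sep: "0 \<le> a \<bullet> x + b * t" if "x0 + x \<in> K" "\<phi> (x0 + x) < \<phi> x0 + t" for x t
    using ab(2) that by (auto simp: S_def inner_prod_def)
  have b0: "0 \<le> b" using sep[of 0 1] x0K by simp
  obtain r where r: "0 < r" "cball x0 r \<subseteq> K" using x0 by (auto simp: mem_interior_cball)
  have "b \<noteq> 0"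
  proof
    assume "b = 0"
    then have "a \<noteq> 0" using ab by (auto simp: zero_prod_def)
    define x where "x = - (r / norm a) *\<^sub>R a"
    have "norm x = r" using \<open>a \<noteq> 0\<close> r by (simp add: x_def)
    then have "x0 + x \<in> cball x0 r" by (simp add: dist_norm)
    then have "x0 + x \<in> K" using r by blast
    then have "0 \<le> a \<bullet> x" using sep[of x "\<phi> (x0 + x) - \<phi> x0 + 1"] \<open>b = 0\<close> by simp
    moreover have "a \<bullet> x = - r * norm a"
      using \<open>a \<noteq> 0\<close> by (simp add: x_def dot_square_norm power2_eq_square)
    ultimately show False using r \<open>a \<noteq> 0\<close> by (simp add: mult_le_0_iff)
  qed
  then have b: "0 < b" using b0 by simp
  have "\<phi> x0 + (- (1/b) *\<^sub>R a) \<bullet> (x - x0) \<le> \<phi> x" if x: "x \<in> K" for x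
  proof (rule field_le_epsilon)
    fix e :: real assume "0 < e"
    then have "0 \<le> a \<bullet> (x - x0) + b * (\<phi> x - \<phi> x0 + e)"
      using sep[of "x - x0" "\<phi> x - \<phi> x0 + e"] x by simp
    then show "\<phi> x0 + (- (1/b) *\<^sub>R a) \<bullet> (x - x0) \<le> \<phi> x + e"
      using b by (simp add: field_simps)
  qed
  then show ?thesis using that by blast
qed

section \<open>The inequality for regular densities\<close>

lemma log_concave_convex_pos:
  assumes "log_concave f"
  shows "convex {x. 0 < f x}"
proof (rule convexI)
  fix x y and u v :: real
  assume *: "x \<in> {x. 0 < f x}" "y \<in> {x. 0 < f x}" "0 \<le> u" "0 \<le> v" "u + v = 1"
  show "u *\<^sub>R x + v *\<^sub>R y \<in> {x. 0 < f x}"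
  proof (cases "v = 0 \<or> v = 1")
    case True
    then show ?thesis using * by auto
  next
    case False
    have "0 < f x powr (1 - v) * f y powr v" using * by auto
    also have "\<dots> \<le> f ((1 - v) *\<^sub>R x + v *\<^sub>R y)" using assms False * by (auto simp: log_concave_def)
    also have "1 - v = u" using * by simp
    finally show ?thesis by simp
  qed
qed

text \<open>An integrable log-concave density that is continuous on its support \<open>{x. 0 < f x}\<close>, which is open
  and contains the origin, together with a direction \<open>\<theta>\<close>. No condition on the barycentre is
  imposed here.\<close>

locale regular_log_concave =
  fixes f :: "'a::euclidean_space \<Rightarrow> real" and \<theta> :: 'a
  assumes lc: "log_concave f" and int: "integrable lborel f"
    and open_pos: "open {x. 0 < f x}" and cont: "continuous_on {x. 0 < f x} f"
    and pos_0: "0 < f 0" and norm_\<theta>: "norm \<theta> = 1"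
begin

lemma nonneg: "0 \<le> f x"
  using lc by (auto simp: log_concave_def)

lemma log_concave_ineq: "0 < l \<Longrightarrow> l < 1 \<Longrightarrow> f x powr (1 - l) * f y powr l \<le> f ((1 - l) *\<^sub>R x + l *\<^sub>R y)"
  using lc by (auto simp: log_concave_def)

lemma f_borel [measurable]: "f \<in> borel_measurable borel"
  using int by auto

lemma convex_pos: "convex {x. 0 < f x}"
  using lc by (rule log_concave_convex_pos)

lemma ex_ball_ge: obtains r c where "0 < r" "0 < c" "\<And>b. norm b < r \<Longrightarrow> c \<le> f b"
proof -
  have "isCont f 0" using cont open_pos pos_0 by (simp add: continuous_on_eq_continuous_at)
  then have "eventually (\<lambda>x. f 0 / 2 < f x) (nhds 0)"
    using pos_0 by (auto simp: isCont_def tendsto_at_iff_tendsto_nhds dest: order_tendstoD(1)[of f "f 0" "nhds 0" "f 0 / 2"])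
  then obtain r where "0 < r" "\<forall>x. dist x 0 < r \<longrightarrow> f 0 / 2 < f x" by (auto simp: eventually_nhds_metric)
  then show ?thesis using that[of r "f 0 / 2"] pos_0 by (auto simp: less_imp_le)
qed

lemma midpoint_ge:
  assumes "\<And>b. norm b < r \<Longrightarrow> c \<le> f b" "0 < c" "z \<in> ball ((1/2) *\<^sub>R x) (r/2)"
  shows "sqrt (c * f x) \<le> f z"
proof -
  define b where "b = 2 *\<^sub>R z - x"
  have "b = 2 *\<^sub>R (z - (1/2) *\<^sub>R x)" by (simp add: b_def algebra_simps)
  then have "norm b < r" using assms(3) by (simp add: dist_norm norm_minus_commute)
  then have cb: "c \<le> f b" by (rule assms)
  have "sqrt (c * f x) \<le> sqrt (f x * f b)"
    using cb nonneg[of x] by (simp add: mult.commute mult_right_mono)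
  also have "\<dots> = f x powr (1 - 1/2) * f b powr (1/2)"
    using nonneg by (simp add: real_sqrt_mult powr_half_sqrt)
  also have "\<dots> \<le> f ((1 - 1/2) *\<^sub>R x + (1/2) *\<^sub>R b)" by (rule log_concave_ineq) auto
  also have "(1 - 1/2) *\<^sub>R x + (1/2) *\<^sub>R b = z" by (simp add: b_def algebra_simps)
  finally show ?thesis .
qed

lemma ex_upper_bound: obtains A where "0 < A" "\<And>x. f x \<le> A"
proof -
  obtain r c where rc: "0 < r" "0 < c" "\<And>b. norm b < r \<Longrightarrow> c \<le> f b" by (rule ex_ball_ge) (rule that)
  define V where "V = unit_ball_vol (real DIM('a)) * (r/2) ^ DIM('a)"
  have V: "0 < V" using rc(1) by (simp add: V_def)
  define F where "F = (\<integral>x. f x \<partial>lborel)"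
  have "f x \<le> (F / V)\<^sup>2 / c" for x
  proof -
    let ?B = "ball ((1/2) *\<^sub>R x) (r/2)"
    have "sqrt (c * f x) * V = sqrt (c * f x) * measure lborel ?B"
      using rc(1) by (simp add: V_def content_ball)
    also have "\<dots> = (\<integral>z. sqrt (c * f x) * indicator ?B z \<partial>lborel)" by simp
    also have "\<dots> \<le> F"
      unfolding F_def
    proof (intro integral_mono int)
      show "integrable lborel (\<lambda>z. sqrt (c * f x) * indicator ?B z)"
        by (intro integrable_mult_right integrable_real_indicator emeasure_bounded_finite) auto
      show "sqrt (c * f x) * indicator ?B z \<le> f z" for z
        using midpoint_ge[of r c z x] rc nonneg by (auto simp: indicator_def)
    qed
    finally have "sqrt (c * f x) \<le> F / V" using V by (simp add: field_simps)
    then have "(sqrt (c * f x))\<^sup>2 \<le> (F / V)\<^sup>2"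
      using rc nonneg by (intro power_mono) auto
    then have "c * f x \<le> (F / V)\<^sup>2" using rc nonneg by simp
    then show ?thesis using rc by (simp add: pos_le_divide_eq mult.commute)
  qed
  then have "f x \<le> (F / V)\<^sup>2 / c + 1" for x by (rule order_trans) simp
  moreover have "0 < (F / V)\<^sup>2 / c + 1" using rc by (intro add_nonneg_pos) auto
  ultimately show ?thesis using that by blast
qed

text \<open>Almost every parallel line has finite mass. The line through \<open>x\<close> is compared with one of
  these passing close to \<open>x / 2\<close>.\<close>

lemma integrable_line: "integrable lborel (\<lambda>s. f (x + s *\<^sub>R \<theta>))"
proof -
  define N where "N x = (\<integral>\<^sup>+s. f (x + s *\<^sub>R \<theta>) \<partial>lborel)" for x
  have [measurable]: "N \<in> borel_measurable borel" unfolding N_def by measurable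
  obtain p :: "real \<Rightarrow> ennreal" where p[measurable]: "p \<in> borel_measurable borel" and p0: "\<And>t. 0 < p t"
    and pf: "(\<integral>\<^sup>+t. p t \<partial>lborel) \<noteq> \<infinity>" by (rule ex_positive_integrable_weight) (rule that)
  have "(\<integral>\<^sup>+x. p (x \<bullet> \<theta>) * N x \<partial>lborel) = (\<integral>\<^sup>+x. f x \<partial>lborel) * (\<integral>\<^sup>+t. p t \<partial>lborel)"
    unfolding N_def by (rule nn_integral_line_average) (use norm_\<theta> in auto)
  also have "\<dots> \<noteq> \<infinity>"
    using int pf nonneg by (simp add: nn_integral_eq_integral ennreal_mult_eq_top_iff)
  finally have "AE x in lborel. p (x \<bullet> \<theta>) * N x \<noteq> \<infinity>"
    by (intro nn_integral_PInf_AE) auto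
  then have ae: "AE x in lborel. N x \<noteq> \<infinity>"
    by (rule AE_mp) (use p0 in \<open>auto simp: ennreal_mult_eq_top_iff less_le\<close>)
  obtain r c where rc: "0 < r" "0 < c" "\<And>b. norm b < r \<Longrightarrow> c \<le> f b" by (rule ex_ball_ge) (rule that)
  obtain A where A: "0 < A" "\<And>x. f x \<le> A" by (rule ex_upper_bound) (rule that)
  have "\<exists>z\<in>ball ((1/2) *\<^sub>R x) (r/2). N z \<noteq> \<infinity>"
  proof (rule ccontr)
    assume "\<not> ?thesis"
    then have "AE z in lborel. z \<notin> ball ((1/2) *\<^sub>R x) (r/2)"
      using ae by (auto elim!: eventually_mono)
    then have "ball ((1/2) *\<^sub>R x) (r/2) \<in> null_sets lborel"
      by (subst AE_iff_null_sets) auto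
    then have "emeasure lborel (ball ((1/2) *\<^sub>R x) (r/2)) = 0" by (rule null_setsD1)
    moreover have "0 < unit_ball_vol (real DIM('a)) * (r/2) ^ DIM('a)" using rc(1) by simp
    ultimately show False using rc(1) by (simp add: emeasure_ball ennreal_eq_0_iff)
  qed
  then obtain z where z: "z \<in> ball ((1/2) *\<^sub>R x) (r/2)" "N z \<noteq> \<infinity>" by blast
  define k where "k = sqrt c / sqrt A"
  have k: "0 < k" using rc A by (simp add: k_def)
  have le: "k * f (x + (2 * s) *\<^sub>R \<theta>) \<le> f (z + s *\<^sub>R \<theta>)" for s
  proof -
    let ?y = "x + (2 * s) *\<^sub>R \<theta>"
    have "dist ((1/2) *\<^sub>R ?y) (z + s *\<^sub>R \<theta>) = dist ((1/2) *\<^sub>R x) z"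
      by (simp add: dist_norm algebra_simps)
    then have "z + s *\<^sub>R \<theta> \<in> ball ((1/2) *\<^sub>R ?y) (r/2)" using z by simp
    then have "sqrt (c * f ?y) \<le> f (z + s *\<^sub>R \<theta>)" using midpoint_ge[of r c "z + s *\<^sub>R \<theta>" ?y] rc by simp
    moreover have "k * f ?y \<le> sqrt (c * f ?y)"
    proof -
      have "f ?y = sqrt (f ?y) * sqrt (f ?y)" using nonneg by simp
      also have "\<dots> \<le> sqrt A * sqrt (f ?y)" using A nonneg by (intro mult_right_mono) auto
      finally have "sqrt c * f ?y \<le> sqrt c * (sqrt A * sqrt (f ?y))" using rc by (intro mult_left_mono) auto
      then show ?thesis using A by (simp add: k_def real_sqrt_mult field_simps)
    qed
    ultimately show ?thesis by linarith
  qed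
  have "(\<integral>\<^sup>+s. f (x + s *\<^sub>R \<theta>) \<partial>lborel) = ennreal \<bar>2\<bar> * (\<integral>\<^sup>+s. f (x + (0 + 2 * s) *\<^sub>R \<theta>) \<partial>lborel)"
    by (rule nn_integral_real_affine) auto
  also have "(\<integral>\<^sup>+s. f (x + (0 + 2 * s) *\<^sub>R \<theta>) \<partial>lborel) \<le> (\<integral>\<^sup>+s. ennreal (1/k) * f (z + s *\<^sub>R \<theta>) \<partial>lborel)"
  proof (intro nn_integral_mono)
    fix s
    have "f (x + (0 + 2 * s) *\<^sub>R \<theta>) \<le> 1/k * f (z + s *\<^sub>R \<theta>)"
      using le[of s] k by (simp add: field_simps)
    then show "ennreal (f (x + (0 + 2 * s) *\<^sub>R \<theta>)) \<le> ennreal (1/k) * f (z + s *\<^sub>R \<theta>)"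
      using k by (simp add: ennreal_leI flip: ennreal_mult')
  qed
  also have "\<dots> = ennreal (1/k) * N z" unfolding N_def by (rule nn_integral_cmult) measurable
  finally have "(\<integral>\<^sup>+s. f (x + s *\<^sub>R \<theta>) \<partial>lborel) \<le> ennreal \<bar>2\<bar> * (ennreal (1/k) * N z)"
    by (simp add: mult_left_mono)
  also have "\<dots> < \<infinity>" using z(2) by (simp add: ennreal_mult_less_top less_top)
  finally show ?thesis using nonneg by (intro integrableI_nonneg) auto
qed

text \<open>The mass of \<open>f\<close> on the line through \<open>x\<close> in the direction \<open>\<theta>\<close>, and on the ray issuing from
  \<open>x\<close> in that direction.\<close>

definition line_mass :: "'a \<Rightarrow> real" where
  "line_mass x = (\<integral>s. f (x + s *\<^sub>R \<theta>) \<partial>lborel)"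

definition ray_mass :: "'a \<Rightarrow> real" where
  "ray_mass x = (\<integral>s. indicator {0..} s * f (x + s *\<^sub>R \<theta>) \<partial>lborel)"

lemma integrable_ray: "integrable lborel (\<lambda>s. indicator {0..} s * f (x + s *\<^sub>R \<theta>))"
  using integrable_mult_indicator[OF _ integrable_line, of "{0..}"] by simp

lemma nn_integral_line: "(\<integral>\<^sup>+s. f (x + s *\<^sub>R \<theta>) \<partial>lborel) = ennreal (line_mass x)"
  unfolding line_mass_def by (rule nn_integral_eq_integral[OF integrable_line]) (use nonneg in auto)

lemma nn_integral_ray: "(\<integral>\<^sup>+s\<in>{0..}. f (x + s *\<^sub>R \<theta>) \<partial>lborel) = ennreal (ray_mass x)"
  unfolding ray_mass_def
  by (subst nn_integral_eq_integral[OF integrable_ray, symmetric])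
    (use nonneg in \<open>auto intro!: nn_integral_cong simp: indicator_def\<close>)

lemma line_mass_borel [measurable]: "line_mass \<in> borel_measurable borel"
  unfolding line_mass_def by measurable

lemma ray_mass_borel [measurable]: "ray_mass \<in> borel_measurable borel"
  unfolding ray_mass_def by measurable

lemma ray_mass_nonneg: "0 \<le> ray_mass x"
  unfolding ray_mass_def using nonneg by (intro Bochner_Integration.integral_nonneg) auto

lemma bdd_line: "bdd_above (range (\<lambda>s. f (x + s *\<^sub>R \<theta>)))"
  using ex_upper_bound by (metis bdd_above.I2)

lemma bdd_ray: "bdd_above (range (\<lambda>s. indicator {0..} s * f (x + s *\<^sub>R \<theta>)))"
proof -
  obtain A where "0 < A" "\<And>x. f x \<le> A" by (rule ex_upper_bound) (rule that)
  then show ?thesis by (intro bdd_aboveI[of _ A]) (auto simp: indicator_def)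
qed

lemma line_log_concave_ineq:
  assumes "0 < l" "l < 1"
  shows "f (x + s *\<^sub>R \<theta>) powr (1 - l) * f (y + t *\<^sub>R \<theta>) powr l
    \<le> f (((1 - l) *\<^sub>R x + l *\<^sub>R y) + ((1 - l) * s + l * t) *\<^sub>R \<theta>)"
  using log_concave_ineq[OF assms, of "x + s *\<^sub>R \<theta>" "y + t *\<^sub>R \<theta>"] by (simp add: algebra_simps)

lemma line_mass_log_concave:
  assumes "0 < l" "l < 1"
  shows "line_mass x powr (1 - l) * line_mass y powr l \<le> line_mass ((1 - l) *\<^sub>R x + l *\<^sub>R y)"
  unfolding line_mass_def
  by (rule prekopa_leindler_real[OF integrable_line integrable_line integrable_line _ _ _ bdd_line bdd_line assms])
     (use line_log_concave_ineq[OF assms] nonneg in auto)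

lemma ray_mass_log_concave:
  assumes "0 < l" "l < 1"
  shows "ray_mass x powr (1 - l) * ray_mass y powr l \<le> ray_mass ((1 - l) *\<^sub>R x + l *\<^sub>R y)"
  unfolding ray_mass_def
proof (rule prekopa_leindler_real[OF integrable_ray integrable_ray integrable_ray _ _ _ bdd_ray bdd_ray assms])
  fix s t :: real
  have "0 \<le> (1 - l) * s + l * t" if "0 \<le> s" "0 \<le> t" using that assms by simp
  then show "(indicator {0..} s * f (x + s *\<^sub>R \<theta>)) powr (1 - l) * (indicator {0..} t * f (y + t *\<^sub>R \<theta>)) powr l
    \<le> indicator {0..} ((1 - l) * s + l * t) *
       f (((1 - l) *\<^sub>R x + l *\<^sub>R y) + ((1 - l) * s + l * t) *\<^sub>R \<theta>)"
    using line_log_concave_ineq[OF assms, of x s y t] nonneg by (auto simp: indicator_def)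
qed (use nonneg in auto)

lemma ray_mass_pos:
  assumes "0 < f x"
  shows "0 < ray_mass x"
proof -
  obtain e where e: "0 < e" "ball x e \<subseteq> {x. 0 < f x}" by (rule openE[OF open_pos]) (use assms in auto)
  have "ray_mass x \<noteq> 0"
  proof
    assume "ray_mass x = 0"
    then have "AE s in lborel. indicator {0..} s * f (x + s *\<^sub>R \<theta>) = 0"
      using nonneg by (simp add: ray_mass_def integral_nonneg_eq_0_iff_AE[OF integrable_ray])
    then have "AE s in lborel. s \<notin> {0..<e}"
    proof (rule AE_mp, intro AE_I2 impI)
      fix s assume *: "indicator {0..} s * f (x + s *\<^sub>R \<theta>) = 0"
      show "s \<notin> {0..<e}"
      proof
        assume s: "s \<in> {0..<e}"
        then have "x + s *\<^sub>R \<theta> \<in> ball x e" by (simp add: dist_norm norm_\<theta>)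
        then show False using e s * by auto
      qed
    qed
    then have "{0..<e} \<in> null_sets lborel" by (subst AE_iff_null_sets) auto
    then have "emeasure lborel {0..<e} = 0" by (rule null_setsD1)
    then show False using e by simp
  qed
  then show ?thesis using ray_mass_nonneg[of x] by simp
qed

lemma ray_mass_le_line_mass: "ray_mass x \<le> line_mass x"
  unfolding ray_mass_def line_mass_def
  by (intro integral_mono integrable_ray integrable_line) (use nonneg in \<open>auto simp: indicator_def\<close>)

lemma ray_mass_shift: "ray_mass (x + s *\<^sub>R \<theta>) = (LINT r:{s..}|lborel. f (x + r *\<^sub>R \<theta>))"
proof -
  have "(LINT r:{s..}|lborel. f (x + r *\<^sub>R \<theta>)) = \<bar>1\<bar> *\<^sub>R (\<integral>r. indicator {s..} (s + 1 * r) *\<^sub>R f (x + (s + 1 * r) *\<^sub>R \<theta>) \<partial>lborel)"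
    unfolding set_lebesgue_integral_def by (rule lborel_integral_real_affine) auto
  also have "\<dots> = ray_mass (x + s *\<^sub>R \<theta>)"
    by (auto simp: ray_mass_def indicator_def algebra_simps intro!: Bochner_Integration.integral_cong)
  finally show ?thesis by simp
qed

lemma nn_integral_ray_powr_le:
  assumes l: "0 < l" "l < 1"
  shows "(\<integral>\<^sup>+s. ennreal (f (x + s *\<^sub>R \<theta>) * ray_mass (x + s *\<^sub>R \<theta>) powr (l - 1)) \<partial>lborel)
    \<le> ennreal (line_mass x powr l / l)"
proof -
  let ?g = "\<lambda>s. x + s *\<^sub>R \<theta>"
  have eq: "{s. 0 < f (?g s)} = ?g -` {y. 0 < f y}" by auto
  have "open {s. 0 < f (?g s)}"
    unfolding eq by (rule open_vimage[OF open_pos]) (intro continuous_intros)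
  moreover have "convex {s. 0 < f (?g s)}"
  proof (rule convexI)
    fix s t u v :: real
    assume *: "s \<in> {s. 0 < f (?g s)}" "t \<in> {s. 0 < f (?g s)}" "0 \<le> u" "0 \<le> v" "u + v = 1"
    have "u *\<^sub>R ?g s + v *\<^sub>R ?g t = (u + v) *\<^sub>R x + (u *\<^sub>R s + v *\<^sub>R t) *\<^sub>R \<theta>"
      by (simp add: algebra_simps)
    then have "u *\<^sub>R ?g s + v *\<^sub>R ?g t = ?g (u *\<^sub>R s + v *\<^sub>R t)" using * by simp
    then show "u *\<^sub>R s + v *\<^sub>R t \<in> {s. 0 < f (?g s)}"
      using convexD[OF convex_pos, of "?g s" "?g t" u v] * by auto
  qed
  moreover have "continuous_on {s. 0 < f (?g s)} (\<lambda>s. f (?g s))"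
    by (rule continuous_on_compose2[OF cont]) (auto intro!: continuous_intros)
  ultimately show ?thesis
    unfolding ray_mass_shift line_mass_def
    using nonneg by (intro nn_integral_tail_powr_le integrable_line l) auto
qed

text \<open>Integrating over the lines parallel to \<open>\<theta>\<close> replaces \<open>f * ray_mass powr (l - 1)\<close> by
  \<open>line_mass powr l / l\<close>; log-concavity of \<open>line_mass\<close> between \<open>0\<close> and \<open>x\<close> bounds this by
  a multiple of \<open>line_mass (l *\<^sub>R x)\<close>, and the dilation costs a power of \<open>l\<close>.\<close>

lemma nn_integral_ray_mass_powr_le:
  assumes l: "0 < l" "l < 1"
  shows "(\<integral>\<^sup>+x. ennreal (f x * ray_mass x powr (l - 1)) \<partial>lborel)
    \<le> ennreal (line_mass 0 powr (l - 1) / l ^ DIM('a) * (\<integral>x. f x \<partial>lborel))"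
proof -
  obtain p :: "real \<Rightarrow> ennreal" where p[measurable]: "p \<in> borel_measurable borel" 
    and pf: "(\<integral>\<^sup>+t. p t \<partial>lborel) \<noteq> \<infinity>" "(\<integral>\<^sup>+t. p t \<partial>lborel) \<noteq> 0" by (rule ex_positive_integrable_weight) (rule that)
  define P where "P = (\<integral>\<^sup>+t. p t \<partial>lborel)"
  define F where "F = (\<integral>x. f x \<partial>lborel)"
  define n where "n = DIM('a)"
  have M0: "0 < line_mass 0" using ray_mass_pos[OF pos_0] ray_mass_le_line_mass[of 0] by simp
  have F: "0 \<le> F" using nonneg by (auto simp: F_def intro!: Bochner_Integration.integral_nonneg)
  have nnF: "(\<integral>\<^sup>+x. f x \<partial>lborel) = ennreal F"
    unfolding F_def by (rule nn_integral_eq_integral[OF int]) (use nonneg in auto)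
  define k where "k = line_mass 0 powr (l - 1) / l"
  have k: "0 \<le> k" using l by (simp add: k_def)
  have M: "line_mass x powr l / l \<le> k * line_mass (l *\<^sub>R x)" for x
  proof -
    have "line_mass 0 powr (1 - l) * line_mass x powr l \<le> line_mass (l *\<^sub>R x)"
      using line_mass_log_concave[OF l, of 0 x] by simp
    then have "line_mass 0 powr (l - 1) * (line_mass 0 powr (1 - l) * line_mass x powr l) / l
        \<le> line_mass 0 powr (l - 1) * line_mass (l *\<^sub>R x) / l"
      using l by (intro divide_right_mono mult_left_mono) auto
    moreover have "line_mass 0 powr (l - 1) * line_mass 0 powr (1 - l) = 1"
      using M0 by (simp flip: powr_add)
    ultimately show ?thesis by (simp add: k_def flip: mult.assoc)
  qed
  \<comment> \<open>The dilation by \<open>l\<close> is undone by rescaling the weight.\<close>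
  have "ennreal (l ^ n) * (\<integral>\<^sup>+x. p (x \<bullet> \<theta>) * line_mass (l *\<^sub>R x) \<partial>lborel)
      = ennreal (\<bar>l\<bar> ^ DIM('a)) * (\<integral>\<^sup>+x. p ((l *\<^sub>R x) \<bullet> \<theta> / l) * line_mass (l *\<^sub>R x) \<partial>lborel)"
    using l by (simp add: n_def)
  also have "\<dots> = (\<integral>\<^sup>+x. p (x \<bullet> \<theta> / l) * line_mass x \<partial>lborel)"
    using l by (subst nn_integral_lborel_scale[of _ l, symmetric]) auto
  also have "\<dots> = (\<integral>\<^sup>+x. p (x \<bullet> \<theta> / l) * (\<integral>\<^sup>+s. f (x + s *\<^sub>R \<theta>) \<partial>lborel) \<partial>lborel)"
    by (simp add: nn_integral_line)
  also have "\<dots> = (\<integral>\<^sup>+x. f x \<partial>lborel) * (\<integral>\<^sup>+s. p (s / l) \<partial>lborel)"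
    by (rule nn_integral_line_average[of _ "\<lambda>s. p (s / l)"]) (use norm_\<theta> in auto)
  also have "(\<integral>\<^sup>+s. p (s / l) \<partial>lborel) = ennreal \<bar>l\<bar> * (\<integral>\<^sup>+s. p ((0 + l * s) / l) \<partial>lborel)"
    using l by (intro nn_integral_real_affine) auto
  also have "\<dots> = ennreal l * P" using l by (simp add: P_def)
  finally have scaled: "ennreal (l ^ n) * (\<integral>\<^sup>+x. p (x \<bullet> \<theta>) * line_mass (l *\<^sub>R x) \<partial>lborel) = ennreal (F * l) * P"
    using F l by (simp add: nnF ennreal_mult mult.assoc)
  have "(\<integral>\<^sup>+x. p (x \<bullet> \<theta>) * line_mass (l *\<^sub>R x) \<partial>lborel)
      = ennreal (1 / l ^ n) * (ennreal (l ^ n) * (\<integral>\<^sup>+x. p (x \<bullet> \<theta>) * line_mass (l *\<^sub>R x) \<partial>lborel))"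
    using l by (simp flip: ennreal_mult' mult.assoc)
  also have "\<dots> = ennreal (F * l / l ^ n) * P"
    unfolding scaled using l F by (simp flip: ennreal_mult' mult.assoc)
  finally have scaled': "(\<integral>\<^sup>+x. p (x \<bullet> \<theta>) * line_mass (l *\<^sub>R x) \<partial>lborel) = ennreal (F * l / l ^ n) * P" .
  have "(\<integral>\<^sup>+x. ennreal (f x * ray_mass x powr (l - 1)) \<partial>lborel) * P
      = (\<integral>\<^sup>+x. p (x \<bullet> \<theta>) * (\<integral>\<^sup>+s. ennreal (f (x + s *\<^sub>R \<theta>) * ray_mass (x + s *\<^sub>R \<theta>) powr (l - 1)) \<partial>lborel) \<partial>lborel)"
    unfolding P_def by (rule nn_integral_line_average[symmetric]) (use norm_\<theta> in auto)
  also have "\<dots> \<le> (\<integral>\<^sup>+x. ennreal k * (p (x \<bullet> \<theta>) * ennreal (line_mass (l *\<^sub>R x))) \<partial>lborel)"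
  proof (rule nn_integral_mono)
    fix x
    have "(\<integral>\<^sup>+s. ennreal (f (x + s *\<^sub>R \<theta>) * ray_mass (x + s *\<^sub>R \<theta>) powr (l - 1)) \<partial>lborel)
        \<le> ennreal (k * line_mass (l *\<^sub>R x))"
      using nn_integral_ray_powr_le[OF l, of x] M[of x] by (meson ennreal_leI order_trans)
    then have "p (x \<bullet> \<theta>) * (\<integral>\<^sup>+s. ennreal (f (x + s *\<^sub>R \<theta>) * ray_mass (x + s *\<^sub>R \<theta>) powr (l - 1)) \<partial>lborel)
        \<le> p (x \<bullet> \<theta>) * ennreal (k * line_mass (l *\<^sub>R x))" by (rule mult_left_mono) simp
    also have "\<dots> = ennreal k * (p (x \<bullet> \<theta>) * ennreal (line_mass (l *\<^sub>R x)))"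
      using k by (simp add: ennreal_mult' mult_ac)
    finally show "p (x \<bullet> \<theta>) * (\<integral>\<^sup>+s. ennreal (f (x + s *\<^sub>R \<theta>) * ray_mass (x + s *\<^sub>R \<theta>) powr (l - 1)) \<partial>lborel)
        \<le> ennreal k * (p (x \<bullet> \<theta>) * ennreal (line_mass (l *\<^sub>R x)))" .
  qed
  also have "\<dots> = ennreal k * (ennreal (F * l / l ^ n) * P)"
    by (simp add: nn_integral_cmult scaled')
  also have "\<dots> = ennreal (k * (F * l / l ^ n)) * P"
    using ennreal_mult'[OF k, of "F * l / l ^ n"] by (simp only: mult.assoc)
  also have "k * (F * l / l ^ n) = line_mass 0 powr (l - 1) / l ^ n * F"
    using l by (simp add: k_def)
  finally have "(\<integral>\<^sup>+x. ennreal (f x * ray_mass x powr (l - 1)) \<partial>lborel) * P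
      \<le> ennreal (line_mass 0 powr (l - 1) / l ^ n * F) * P" .
  then show ?thesis
    using pf unfolding F_def n_def P_def[symmetric]
    by (simp add: ennreal_mult_le_mult_iff mult.commute[of _ P] less_top)
qed

text \<open>Jensen's inequality for the convex function \<open>ray_mass powr (- e)\<close> on the support, in the form of
  the subgradient inequality at the barycentre.\<close>

lemma ray_mass_powr_le_nn_integral:
  assumes centre: "has_bochner_integral lborel (\<lambda>x. f x *\<^sub>R x) 0" and e: "0 < e"
    and B: "0 \<le> B" "(\<integral>\<^sup>+x. ennreal (f x * ray_mass x powr (- e)) \<partial>lborel) \<le> ennreal B"
  shows "ray_mass 0 powr (- e) * (\<integral>x. f x \<partial>lborel) \<le> B"
proof -
  define K where "K = {x. 0 < f x}"
  have G0: "0 < ray_mass 0" by (rule ray_mass_pos[OF pos_0])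
  have "convex_on K (\<lambda>x. - ln (ray_mass x))"
  proof (rule convex_onI)
    show "convex K" unfolding K_def by (rule convex_pos)
    fix t :: real and x y assume t: "0 < t" "t < 1" and xy: "x \<in> K" "y \<in> K"
    have pos: "0 < ray_mass x" "0 < ray_mass y" using xy by (auto simp: K_def ray_mass_pos)
    have "(1 - t) * ln (ray_mass x) + t * ln (ray_mass y) = ln (ray_mass x powr (1 - t) * ray_mass y powr t)"
      using pos by (simp add: ln_mult ln_powr)
    also have "\<dots> \<le> ln (ray_mass ((1 - t) *\<^sub>R x + t *\<^sub>R y))"
      using pos ray_mass_log_concave[OF t, of x y] by (intro ln_mono) auto
    finally show "- ln (ray_mass ((1 - t) *\<^sub>R x + t *\<^sub>R y)) \<le> (1 - t) * - ln (ray_mass x) + t * - ln (ray_mass y)"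
      by simp
  qed
  moreover have "0 \<in> interior K" using open_pos pos_0 by (simp add: K_def interior_open)
  ultimately obtain q where q: "\<And>x. x \<in> K \<Longrightarrow> - ln (ray_mass 0) + q \<bullet> (x - 0) \<le> - ln (ray_mass x)"
    using convex_on_ex_subgradient by blast
  define g where "g = (\<lambda>x. f x * ray_mass x powr (- e))"
  have g0: "0 \<le> g x" for x using nonneg by (simp add: g_def)
  have g_int: "integrable lborel g"
    unfolding g_def using B nonneg by (intro integrableI_nonneg) (auto simp: le_less_trans)
  have h: "has_bochner_integral lborel (\<lambda>x. ray_mass 0 powr (- e) * (f x + e * (q \<bullet> (f x *\<^sub>R x))))
      (ray_mass 0 powr (- e) * ((\<integral>x. f x \<partial>lborel) + e * (q \<bullet> 0)))"
    by (intro has_bochner_integral_mult_right has_bochner_integral_add has_bochner_integral_inner_right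
        has_bochner_integral_integrable int centre)
  have "ray_mass 0 powr (- e) * (\<integral>x. f x \<partial>lborel)
      = (\<integral>x. ray_mass 0 powr (- e) * (f x + e * (q \<bullet> (f x *\<^sub>R x))) \<partial>lborel)"
    using has_bochner_integral_integral_eq[OF h, symmetric] by simp
  also have "\<dots> \<le> (\<integral>x. g x \<partial>lborel)"
  proof (intro integral_mono g_int)
    show "integrable lborel (\<lambda>x. ray_mass 0 powr (- e) * (f x + e * (q \<bullet> (f x *\<^sub>R x))))"
      using h by (rule has_bochner_integral_iff[THEN iffD1, THEN conjunct1])
    fix x
    show "ray_mass 0 powr (- e) * (f x + e * (q \<bullet> (f x *\<^sub>R x))) \<le> g x"
    proof (cases "x \<in> K")
      case False
      then have "f x = 0" using nonneg[of x] by (simp add: K_def)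
      then show ?thesis by (simp add: g_def)
    next
      case True
      have Gx: "0 < ray_mass x" using True by (simp add: K_def ray_mass_pos)
      have "ray_mass 0 powr (- e) * (1 + e * (q \<bullet> x)) \<le> ray_mass 0 powr (- e) * exp (e * (q \<bullet> x))"
        by (intro mult_left_mono exp_ge_add_one_self) auto
      also have "\<dots> = exp (e * (- ln (ray_mass 0) + q \<bullet> x))"
        using G0 by (simp add: powr_def algebra_simps flip: exp_add)
      also have "\<dots> \<le> exp (e * (- ln (ray_mass x)))"
        using mult_left_mono[OF q[OF True], of e] e by simp
      also have "\<dots> = ray_mass x powr (- e)" using Gx by (simp add: powr_def)
      finally have "f x * (ray_mass 0 powr (- e) * (1 + e * (q \<bullet> x))) \<le> g x"
        unfolding g_def using nonneg by (intro mult_left_mono)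
      then show ?thesis by (simp add: algebra_simps)
    qed
  qed
  also have "\<dots> \<le> B"
    using B g0 nn_integral_eq_integral[OF g_int] by (simp add: g_def)
  finally show ?thesis .
qed

text \<open>The two bounds give \<open>(line_mass 0 / ray_mass 0) powr e \<le> 1 / (1 - e) ^ DIM('a)\<close>; its logarithm
  divided by \<open>e\<close> is then estimated as \<open>e\<close> tends to \<open>0\<close>.\<close>

theorem line_mass_le_exp_ray_mass:
  assumes centre: "has_bochner_integral lborel (\<lambda>x. f x *\<^sub>R x) 0" and F: "0 < (\<integral>x. f x \<partial>lborel)"
  shows "line_mass 0 \<le> exp (real DIM('a)) * ray_mass 0"
proof -
  define n where "n = DIM('a)"
  define F where "F = (\<integral>x. f x \<partial>lborel)"
  have G0: "0 < ray_mass 0" by (rule ray_mass_pos[OF pos_0])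
  then have M0: "0 < line_mass 0" using ray_mass_le_line_mass[of 0] by simp
  define L where "L = ln (line_mass 0) - ln (ray_mass 0)"
  have step: "L * (1 - e) \<le> real n" if e: "0 < e" "e < 1" for e
  proof -
    define l where "l = 1 - e"
    have l: "0 < l" "l < 1" "l - 1 = - e" using e by (auto simp: l_def)
    have "ray_mass 0 powr (- e) * F \<le> line_mass 0 powr (- e) / l ^ n * F"
      unfolding F_def
      by (rule ray_mass_powr_le_nn_integral[OF centre e(1)])
         (use nn_integral_ray_mass_powr_le[OF l(1,2)] l F in \<open>auto simp: n_def\<close>)
    then have "ray_mass 0 powr (- e) \<le> line_mass 0 powr (- e) / l ^ n"
      using F by (simp add: F_def del: times_divide_eq_left)
    then have "ln (ray_mass 0 powr (- e)) \<le> ln (line_mass 0 powr (- e) / l ^ n)"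
      using G0 by (intro ln_mono) auto
    also have "\<dots> = - e * ln (line_mass 0) - real n * ln l"
      using M0 l by (simp add: ln_div ln_powr ln_realpow)
    finally have "e * L \<le> - real n * ln l" using G0 by (simp add: L_def ln_powr algebra_simps)
    also have "- real n * ln l = real n * ln (1 / l)" using l by (simp add: ln_div)
    also have "\<dots> \<le> real n * (1 / l - 1)" using l by (intro mult_left_mono ln_le_minus_one) auto
    also have "\<dots> = real n * e / l" using l by (simp add: l_def field_simps)
    finally have "e * (L * l) \<le> e * real n" using l by (simp add: field_simps)
    then show ?thesis using e by (simp add: l_def)
  qed
  have "L \<le> real n"
  proof (rule tendsto_le[of "at_right 0"])
    show "((\<lambda>e. L * (1 - e)) \<longlongrightarrow> L) (at_right 0)" by (auto intro!: tendsto_eq_intros)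
    show "\<forall>\<^sub>F e in at_right 0. L * (1 - e) \<le> real n"
      using step by (auto simp: eventually_at_right_field intro!: exI[of _ 1])
  qed (auto intro: tendsto_const)
  then have "exp (ln (line_mass 0)) \<le> exp (real n + ln (ray_mass 0))" by (simp add: L_def)
  then show ?thesis using G0 M0 by (simp add: exp_add n_def)
qed

end

section \<open>Reduction to regular densities\<close>

lemma log_concave_continuous_on_interior:
  fixes f :: "'a::euclidean_space \<Rightarrow> real"
  assumes "log_concave f"
  shows "continuous_on (interior {x. 0 < f x}) f"
proof -
  define K where "K = interior {x. 0 < f x}"
  have pos: "0 < f x" if "x \<in> K" for x using that interior_subset unfolding K_def by blast
  have "convex_on K (\<lambda>x. - ln (f x))"
  proof (rule convex_onI)
    show "convex K" unfolding K_def by (intro convex_interior log_concave_convex_pos assms)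
    fix t :: real and x y assume t: "0 < t" "t < 1" and xy: "x \<in> K" "y \<in> K"
    have p: "0 < f x" "0 < f y" using xy by (auto simp: pos)
    have "(1 - t) * ln (f x) + t * ln (f y) = ln (f x powr (1 - t) * f y powr t)"
      using p by (simp add: ln_mult ln_powr)
    also have "\<dots> \<le> ln (f ((1 - t) *\<^sub>R x + t *\<^sub>R y))"
      using p t assms by (intro ln_mono) (auto simp: log_concave_def)
    finally show "- ln (f ((1 - t) *\<^sub>R x + t *\<^sub>R y)) \<le> (1 - t) * - ln (f x) + t * - ln (f y)"
      by simp
  qed
  then have "continuous_on K (\<lambda>x. - ln (f x))" by (intro convex_on_continuous) (auto simp: K_def)
  then have "continuous_on K (\<lambda>x. exp (- (- ln (f x))))"
    by (rule continuous_on_exp[OF continuous_on_minus])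
  then show ?thesis
    unfolding K_def[symmetric] by (rule continuous_on_eq) (simp add: pos)
qed

text \<open>If the barycentre were not interior to the support, the support would lie on one side of a
  hyperplane through it, hence almost all of the mass would lie in that hyperplane.\<close>

lemma barycentre_in_interior:
  fixes f :: "'a::euclidean_space \<Rightarrow> real"
  assumes "centered_log_concave f"
  shows "0 \<in> interior {x. 0 < f x}"
proof (rule ccontr)
  define K where "K = {x. 0 < f x}"
  have lc: "log_concave f" and int: "integrable lebesgue f" and F: "0 < (\<integral>x. f x \<partial>lebesgue)"
    and centre: "has_bochner_integral lebesgue (\<lambda>x. f x *\<^sub>R x) 0"
    using assms by (auto simp: centered_log_concave_def)
  have nonneg: "0 \<le> f x" for x using lc by (auto simp: log_concave_def)
  have K: "convex K" unfolding K_def by (rule log_concave_convex_pos[OF lc])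
  assume "0 \<notin> interior {x. 0 < f x}"
  then obtain a where a: "a \<noteq> 0" "\<forall>x\<in>interior K. 0 \<le> a \<bullet> x"
    using separating_hyperplane_set_0[OF convex_interior[OF K]] by (auto simp: K_def)
  have front: "AE x in lebesgue. x \<notin> frontier K"
    using negligible_convex_frontier[OF K] by (simp add: negligible_iff_null_sets AE_not_in)
  have hyper: "AE x in lebesgue. x \<notin> {x. a \<bullet> x = 0}"
    by (rule AE_not_in) (use negligible_hyperplane[of a 0] a in \<open>simp add: negligible_iff_null_sets\<close>)
  have h: "has_bochner_integral lebesgue (\<lambda>x. a \<bullet> (f x *\<^sub>R x)) (a \<bullet> 0)"
    by (intro has_bochner_integral_inner_right centre)
  have "AE x in lebesgue. 0 \<le> a \<bullet> (f x *\<^sub>R x)"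
    using front
  proof (rule AE_mp, intro AE_I2 impI)
    fix x assume "x \<notin> frontier K"
    then have "x \<in> interior K \<or> x \<notin> K" using closure_subset[of K] by (auto simp: frontier_def)
    then show "0 \<le> a \<bullet> (f x *\<^sub>R x)" using a nonneg[of x] by (auto simp: K_def)
  qed
  then have "AE x in lebesgue. a \<bullet> (f x *\<^sub>R x) = 0"
    using h integral_nonneg_eq_0_iff_AE[of lebesgue "\<lambda>x. a \<bullet> (f x *\<^sub>R x)"]
    by (simp add: has_bochner_integral_iff)
  then have "AE x in lebesgue. f x = 0" using hyper by (auto elim: AE_mp)
  then have "(\<integral>x. f x \<partial>lebesgue) = 0" by (rule integral_eq_zero_AE)
  then show False using F by simp
qed

text \<open>Passing from \<open>f\<close> to its restriction to the interior of the support changes neither the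
  integrals over the space nor, as the barycentre is interior, those over lines through it.\<close>

lemma centered_log_concave_ray_ge:
  fixes f :: "'a::euclidean_space \<Rightarrow> real"
  assumes f: "centered_log_concave f" and \<theta>: "norm \<theta> = 1"
  shows "ennreal (exp (- real DIM('a))) * (\<integral>\<^sup>+s. ennreal (f (s *\<^sub>R \<theta>)) \<partial>lebesgue)
    \<le> (\<integral>\<^sup>+s\<in>{0..}. ennreal (f (s *\<^sub>R \<theta>)) \<partial>lebesgue)"
proof -
  define K where "K = {x. 0 < f x}"
  define g where "g x = indicator (interior K) x * f x" for x
  have lc: "log_concave f" and int: "integrable lebesgue f" and F: "0 < (\<integral>x. f x \<partial>lebesgue)"
    and centre: "has_bochner_integral lebesgue (\<lambda>x. f x *\<^sub>R x) 0"
    using f by (auto simp: centered_log_concave_def)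
  have nonneg: "0 \<le> f x" for x using lc by (auto simp: log_concave_def)
  have K: "convex K" unfolding K_def by (rule log_concave_convex_pos[OF lc])
  have zero: "0 \<in> interior K" unfolding K_def by (rule barycentre_in_interior[OF f])
  have pos: "0 < f x" if "x \<in> interior K" for x using subsetD[OF interior_subset that] by (simp add: K_def)
  have g_pos: "{x. 0 < g x} = interior K" using pos by (auto simp: g_def indicator_def)
  have cont: "continuous_on (interior K) f"
    unfolding K_def by (rule log_concave_continuous_on_interior[OF lc])
  have g_cont: "continuous_on {x. 0 < g x} g"
    unfolding g_pos using cont by (rule continuous_on_eq) (simp add: g_def)
  have g_borel [measurable]: "g \<in> borel_measurable borel"
    using borel_measurable_continuous_on_indicator[OF _ cont] by (simp add: g_def[abs_def])
  have eq_off: "f x = g x" if "x \<notin> K - interior K" for x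
    using that nonneg[of x] by (auto simp: g_def K_def indicator_def)
  have g_lc: "log_concave g"
    unfolding log_concave_def
  proof (intro conjI allI ballI)
    show "0 \<le> g x" for x using nonneg by (simp add: g_def)
    fix x y and l :: real assume l: "l \<in> {0<..<1}"
    show "g x powr (1 - l) * g y powr l \<le> g ((1 - l) *\<^sub>R x + l *\<^sub>R y)"
    proof (cases "x \<in> interior K \<and> y \<in> interior K")
      case True
      then have "(1 - l) *\<^sub>R x + l *\<^sub>R y \<in> interior K"
        using l by (intro convexD[OF convex_interior[OF K]]) auto
      then show ?thesis using True l lc by (simp add: g_def log_concave_def)
    next
      case False
      then have "g x powr (1 - l) * g y powr l = 0" by (auto simp: g_def)
      moreover have "0 \<le> g ((1 - l) *\<^sub>R x + l *\<^sub>R y)" using nonneg by (simp add: g_def)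
      ultimately show ?thesis by (rule ord_eq_le_trans)
    qed
  qed
  have ae: "AE x in lebesgue. f x = g x"
  proof -
    have "AE x in lebesgue. x \<notin> frontier K"
      using negligible_convex_frontier[OF K] by (simp add: negligible_iff_null_sets AE_not_in)
    then show ?thesis
      by (rule AE_mp) (use closure_subset[of K] in \<open>auto simp: frontier_def intro!: eq_off\<close>)
  qed
  have g_leb: "g \<in> borel_measurable lebesgue" by (rule measurable_completion) simp
  have g_int: "integrable lborel g"
    using integrable_cong_AE_imp[OF int g_leb ae] by (simp add: integrable_completion)
  have "(\<integral>x. g x \<partial>lborel) = (\<integral>x. f x \<partial>lebesgue)"
    using integral_cong_AE[OF _ g_leb ae] int by (simp add: integral_completion)
  then have g_F: "0 < (\<integral>x. g x \<partial>lborel)" using F by simp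
  have "has_bochner_integral lebesgue (\<lambda>x. g x *\<^sub>R x) 0"
  proof (rule has_bochner_integral_cong_AE[THEN iffD1, OF _ _ _ centre])
    show "(\<lambda>x. f x *\<^sub>R x) \<in> borel_measurable lebesgue"
      using centre by (auto simp: has_bochner_integral_iff dest: borel_measurable_integrable)
    show "(\<lambda>x. g x *\<^sub>R x) \<in> borel_measurable lebesgue"
      by (rule measurable_completion) simp
    show "AE x in lebesgue. f x *\<^sub>R x = g x *\<^sub>R x" using ae by (rule AE_mp) auto
  qed
  then have g_centre: "has_bochner_integral lborel (\<lambda>x. g x *\<^sub>R x) 0"
    by (simp add: has_bochner_integral_iff integrable_completion integral_completion)
  interpret regular_log_concave g \<theta>
    by unfold_locales (use g_lc g_int g_cont g_pos zero pos \<theta> in \<open>auto simp: g_def\<close>)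
  have line: "AE s in lebesgue. f (s *\<^sub>R \<theta>) = g (0 + s *\<^sub>R \<theta>)"
  proof -
    define J where "J = {s. s *\<^sub>R \<theta> \<in> K}"
    have "convex J"
    proof (rule convexI)
      fix s t u v :: real
      assume *: "s \<in> J" "t \<in> J" "0 \<le> u" "0 \<le> v" "u + v = 1"
      have "(u *\<^sub>R s + v *\<^sub>R t) *\<^sub>R \<theta> = u *\<^sub>R (s *\<^sub>R \<theta>) + v *\<^sub>R (t *\<^sub>R \<theta>)" by (simp add: algebra_simps)
      then show "u *\<^sub>R s + v *\<^sub>R t \<in> J" using convexD[OF K, of "s *\<^sub>R \<theta>" "t *\<^sub>R \<theta>" u v] * by (simp add: J_def)
    qed
    then have "frontier J \<in> null_sets lebesgue"
      using negligible_convex_frontier by (simp add: negligible_iff_null_sets)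
    then have "AE s in lebesgue. s \<notin> frontier J" by (rule AE_not_in)
    moreover have "s *\<^sub>R \<theta> \<notin> K - interior K" if s: "s \<notin> frontier J" for s
    proof
      assume *: "s *\<^sub>R \<theta> \<in> K - interior K"
      then have "s \<in> J" by (simp add: J_def)
      then have "s \<in> interior J" using s closure_subset[of J] by (auto simp: frontier_def)
      then obtain e where e: "0 < e" "cball s e \<subseteq> J" by (auto simp: mem_interior_cball)
      have "s \<noteq> 0" using * zero by auto
      \<comment> \<open>A point of the support farther out on the same ray puts \<open>s *\<^sub>R \<theta>\<close> in the interior.\<close>
      define t where "t = 1 + e / \<bar>s\<bar>"
      have t: "1 < t" using e \<open>s \<noteq> 0\<close> by (simp add: t_def)
      have "dist s (t * s) = e" using e \<open>s \<noteq> 0\<close> by (simp add: t_def dist_real_def algebra_simps abs_mult)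
      then have "t * s \<in> J" using e by auto
      then have "(t * s) *\<^sub>R \<theta> \<in> K" by (simp add: J_def)
      then have "(t * s) *\<^sub>R \<theta> - (1 - 1 / t) *\<^sub>R ((t * s) *\<^sub>R \<theta> - 0) \<in> interior K"
        using t by (intro mem_interior_convex_shrink K zero) auto
      also have "(t * s) *\<^sub>R \<theta> - (1 - 1 / t) *\<^sub>R ((t * s) *\<^sub>R \<theta> - 0) = s *\<^sub>R \<theta>"
        using t by (simp add: algebra_simps)
      finally show False using * by simp
    qed
    ultimately show ?thesis by (auto elim!: eventually_mono intro!: eq_off)
  qed
  have 1: "(\<integral>\<^sup>+s. ennreal (f (s *\<^sub>R \<theta>)) \<partial>lebesgue) = ennreal (line_mass 0)"
    unfolding nn_integral_line[symmetric] nn_integral_completion[of lborel, symmetric]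
    by (rule nn_integral_cong_AE, rule AE_mp[OF line]) auto
  have 2: "(\<integral>\<^sup>+s\<in>{0..}. ennreal (f (s *\<^sub>R \<theta>)) \<partial>lebesgue) = ennreal (ray_mass 0)"
    unfolding nn_integral_ray[symmetric] nn_integral_completion[of lborel, symmetric]
    by (rule nn_integral_cong_AE, rule AE_mp[OF line]) auto
  have "exp (- real DIM('a)) * line_mass 0 \<le> exp (- real DIM('a)) * (exp (real DIM('a)) * ray_mass 0)"
    using line_mass_le_exp_ray_mass[OF g_centre g_F] by (intro mult_left_mono) auto
  also have "\<dots> = ray_mass 0" by (simp flip: exp_add mult.assoc)
  finally show ?thesis unfolding 1 2 by (simp add: ennreal_leI flip: ennreal_mult')
qed

section \<open>Sharpness\<close>

lemma nn_integral_exp_atLeast: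
  assumes "0 < r"
  shows "(\<integral>\<^sup>+t\<in>{a..}. ennreal (exp (- (r * t))) \<partial>lborel) = ennreal (exp (- (r * a)) / r)"
proof -
  have "(\<integral>\<^sup>+t\<in>{a..}. ennreal (exp (- (r * t))) \<partial>lborel) = ennreal (0 - - (exp (- (r * a)) / r))"
  proof (rule nn_integral_FTC_atLeast)
    have "filterlim (\<lambda>t. - (r * t)) at_bot at_top"
      using filterlim_tendsto_pos_mult_at_top[OF tendsto_const assms filterlim_ident]
      by (simp add: filterlim_uminus_at_top)
    then have "((\<lambda>t. exp (- (r * t))) \<longlongrightarrow> 0) at_top" by (rule filterlim_compose[OF exp_at_bot])
    then have "((\<lambda>t. - (exp (- (r * t)) / r)) \<longlongrightarrow> - (0 / r)) at_top"
      using assms by (intro tendsto_minus tendsto_divide tendsto_const) auto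
    then show "((\<lambda>t. - (exp (- (r * t)) / r)) \<longlongrightarrow> 0) at_top" by simp
  qed (use assms in \<open>auto intro!: derivative_eq_intros\<close>)
  then show ?thesis by simp
qed

text \<open>Up to a constant factor, the density of independent exponential variables, shifted so that each
  coordinate has mean zero. Equality is attained on the diagonal through the origin.\<close>

definition shifted_exponential :: "'a::euclidean_space \<Rightarrow> real" where
  "shifted_exponential x = (\<Prod>b\<in>Basis. indicator {-1..} (x \<bullet> b) * exp (- (x \<bullet> b)))"

lemma shifted_exponential_eq:
  "shifted_exponential x = (if \<forall>b\<in>Basis. - 1 \<le> x \<bullet> b then exp (- (\<Sum>b\<in>Basis. x \<bullet> b)) else 0)"
  by (auto simp: shifted_exponential_def exp_sum sum_negf[symmetric] indicator_def intro!: prod.cong)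

lemma shifted_exponential_nonneg: "0 \<le> shifted_exponential x"
  by (simp add: shifted_exponential_eq)

lemma shifted_exponential_borel [measurable]: "shifted_exponential \<in> borel_measurable borel"
  unfolding shifted_exponential_def by measurable

lemma log_concave_shifted_exponential: "log_concave shifted_exponential"
  unfolding log_concave_def
proof (intro conjI allI ballI)
  show "0 \<le> shifted_exponential x" for x :: 'a by (rule shifted_exponential_nonneg)
  fix x y :: 'a and l :: real assume l: "l \<in> {0<..<1}"
  show "shifted_exponential x powr (1 - l) * shifted_exponential y powr l
      \<le> shifted_exponential ((1 - l) *\<^sub>R x + l *\<^sub>R y)"
  proof (cases "(\<forall>b\<in>Basis. - 1 \<le> x \<bullet> b) \<and> (\<forall>b\<in>Basis. - 1 \<le> y \<bullet> b)")
    case True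
    have "- 1 \<le> (1 - l) * (x \<bullet> b) + l * (y \<bullet> b)" if "b \<in> Basis" for b
    proof -
      have "(1 - l) * (- 1) + l * (- 1) \<le> (1 - l) * (x \<bullet> b) + l * (y \<bullet> b)"
        using True l that by (intro add_mono mult_left_mono) auto
      then show ?thesis by simp
    qed
    moreover have "(\<Sum>b\<in>Basis. ((1 - l) *\<^sub>R x + l *\<^sub>R y) \<bullet> b)
        = (1 - l) * (\<Sum>b\<in>Basis. x \<bullet> b) + l * (\<Sum>b\<in>Basis. y \<bullet> b)"
      by (simp only: inner_add_left inner_scaleR_left sum.distrib sum_distrib_left)
    ultimately show ?thesis
      using True by (simp add: shifted_exponential_eq inner_add_left exp_powr_real mult.commute flip: exp_add)
  next
    case False
    then have "shifted_exponential x powr (1 - l) * shifted_exponential y powr l = 0"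
      by (auto simp: shifted_exponential_eq)
    then show ?thesis using shifted_exponential_nonneg by (rule ord_eq_le_trans)
  qed
qed

lemma has_bochner_integral_shifted_exponential:
  "has_bochner_integral lborel (shifted_exponential :: 'a::euclidean_space \<Rightarrow> real) (exp (real DIM('a)))"
proof (rule has_bochner_integral_nn_integral)
  have "(\<integral>\<^sup>+x. ennreal (shifted_exponential (x::'a)) \<partial>lborel)
      = (\<integral>\<^sup>+x. (\<Prod>b\<in>Basis. ennreal (indicator {-1..} (x \<bullet> b) * exp (- (x \<bullet> b)))) \<partial>(lborel :: 'a measure))"
    by (simp add: shifted_exponential_def prod_ennreal)
  also have "\<dots> = (\<Prod>b\<in>(Basis::'a set). (\<integral>\<^sup>+t. ennreal (indicator {-1..} t * exp (- t)) \<partial>lborel))"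
    by (rule nn_integral_lborel_prod) auto
  also have "(\<integral>\<^sup>+t. ennreal (indicator {-1..} t * exp (- t)) \<partial>lborel) = (\<integral>\<^sup>+t\<in>{-1..}. ennreal (exp (- (1 * t))) \<partial>lborel)"
    by (intro nn_integral_cong) (auto simp: indicator_def)
  also have "\<dots> = ennreal (exp 1)" by (subst nn_integral_exp_atLeast) auto
  also have "(\<Prod>b\<in>(Basis::'a set). ennreal (exp 1)) = ennreal (exp (real DIM('a)))"
    by (simp add: ennreal_power flip: exp_of_nat_mult)
  finally show "(\<integral>\<^sup>+x. ennreal (shifted_exponential (x::'a)) \<partial>lborel) = ennreal (exp (real DIM('a)))" .
qed (auto simp: shifted_exponential_nonneg)

lemma nn_integral_shifted_linear_exp:
  "(\<integral>\<^sup>+t. ennreal (indicator {-1..} t * exp (- t) * (t + 1)) \<partial>lborel) = ennreal (exp 1)"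
proof -
  have "(\<integral>\<^sup>+t\<in>{-1..}. ennreal (exp (- t) * (t + 1)) \<partial>lborel) = ennreal (0 - - (exp (- (- 1)) * (- 1 + 2)))"
  proof (rule nn_integral_FTC_atLeast)
    have "((\<lambda>t::real. - (t ^ 1 / exp t + 2 * (t ^ 0 / exp t))) \<longlongrightarrow> - (0 + 2 * 0)) at_top"
      by (intro tendsto_intros tendsto_power_div_exp_0)
    then show "((\<lambda>t::real. - (exp (- t) * (t + 2))) \<longlongrightarrow> 0) at_top"
      by (simp add: exp_minus field_simps)
    show "0 \<le> exp (- t) * (t + 1)" if "- 1 \<le> t" for t :: real using that by simp
  qed (auto intro!: derivative_eq_intros simp: algebra_simps)
  moreover have "(\<integral>\<^sup>+t. ennreal (indicator {-1..} t * exp (- t) * (t + 1)) \<partial>lborel)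
      = (\<integral>\<^sup>+t\<in>{-1..}. ennreal (exp (- t) * (t + 1)) \<partial>lborel)"
    by (intro nn_integral_cong) (auto simp: indicator_def)
  ultimately show ?thesis by simp
qed

lemma has_bochner_integral_shifted_exponential_coordinate:
  fixes c :: "'a::euclidean_space"
  assumes c: "c \<in> Basis"
  shows "has_bochner_integral lborel (\<lambda>x. shifted_exponential x * (x \<bullet> c)) 0"
proof -
  have "has_bochner_integral lborel (\<lambda>x. shifted_exponential x * (x \<bullet> c + 1)) (exp (real DIM('a)))"
  proof (rule has_bochner_integral_nn_integral)
    let ?h = "\<lambda>b t. indicator {-1..} t * exp (- t) * (if b = c then t + 1 else 1) :: real"
    have "shifted_exponential x * (x \<bullet> c + 1) = (\<Prod>b\<in>Basis. ?h b (x \<bullet> b))" for x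
      using c by (simp add: shifted_exponential_def prod.distrib prod.delta)
    moreover have h0: "0 \<le> ?h b t" for b t by (auto simp: indicator_def)
    ultimately have "(\<integral>\<^sup>+x. ennreal (shifted_exponential x * (x \<bullet> c + 1)) \<partial>lborel)
        = (\<integral>\<^sup>+x. (\<Prod>b\<in>Basis. ennreal (?h b (x \<bullet> b))) \<partial>(lborel :: 'a measure))"
      by (simp add: prod_ennreal)
    also have "\<dots> = (\<Prod>b\<in>Basis. (\<integral>\<^sup>+t. ennreal (?h b t) \<partial>lborel))"
      by (rule nn_integral_lborel_prod) auto
    also have "\<dots> = (\<Prod>b\<in>(Basis::'a set). ennreal (exp 1))"
    proof (rule prod.cong)
      fix b :: 'a
      show "(\<integral>\<^sup>+t. ennreal (?h b t) \<partial>lborel) = ennreal (exp 1)"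
      proof (cases "b = c")
        case True
        then show ?thesis using nn_integral_shifted_linear_exp by simp
      next
        case False
        have "(\<integral>\<^sup>+t. ennreal (indicator {-1..} t * exp (- t)) \<partial>lborel) = (\<integral>\<^sup>+t\<in>{-1..}. ennreal (exp (- (1 * t))) \<partial>lborel)"
          by (intro nn_integral_cong) (auto simp: indicator_def)
        also have "\<dots> = ennreal (exp 1)" by (subst nn_integral_exp_atLeast) auto
        finally show ?thesis using False by simp
      qed
    qed simp
    also have "\<dots> = ennreal (exp (real DIM('a)))"
      by (simp add: ennreal_power flip: exp_of_nat_mult)
    finally show "(\<integral>\<^sup>+x. ennreal (shifted_exponential x * (x \<bullet> c + 1)) \<partial>lborel) = ennreal (exp (real DIM('a)))" .
    show "AE x in lborel. 0 \<le> shifted_exponential x * (x \<bullet> c + 1)"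
    proof (rule AE_I2)
      fix x :: 'a
      show "0 \<le> shifted_exponential x * (x \<bullet> c + 1)"
        using bspec[of Basis "\<lambda>b. - 1 \<le> x \<bullet> b", OF _ c] by (auto simp: shifted_exponential_eq)
    qed
  qed auto
  from has_bochner_integral_diff[OF this has_bochner_integral_shifted_exponential]
  show ?thesis by (simp add: algebra_simps)
qed

lemma centered_log_concave_shifted_exponential:
  "centered_log_concave (shifted_exponential :: 'a::euclidean_space \<Rightarrow> real)"
proof -
  have "has_bochner_integral lborel (\<lambda>x::'a. \<Sum>b\<in>Basis. (shifted_exponential x * (x \<bullet> b)) *\<^sub>R b) (\<Sum>b\<in>Basis. 0 *\<^sub>R b)"
    by (intro has_bochner_integral_sum has_bochner_integral_scaleR_left
        has_bochner_integral_shifted_exponential_coordinate) auto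
  moreover have "(\<Sum>b\<in>Basis. (shifted_exponential x * (x \<bullet> b)) *\<^sub>R b) = shifted_exponential x *\<^sub>R x" for x :: 'a
    by (simp add: euclidean_representation flip: scaleR_scaleR scaleR_sum_right)
  ultimately have c: "has_bochner_integral lborel (\<lambda>x::'a. shifted_exponential x *\<^sub>R x) 0" by simp
  show ?thesis
    using c has_bochner_integral_shifted_exponential[where 'a='a] log_concave_shifted_exponential
    by (simp add: centered_log_concave_def has_bochner_integral_iff integrable_completion integral_completion)
qed

lemma shifted_exponential_diagonal:
  fixes s :: real
  defines "r \<equiv> sqrt (real DIM('a::euclidean_space))"
  shows "shifted_exponential (s *\<^sub>R ((1 / r) *\<^sub>R (\<Sum>Basis :: 'a))) = indicator {- r..} s * exp (- (r * s))"
proof -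
  have r: "0 < r" "r * r = real DIM('a)" by (auto simp: r_def)
  have "real DIM('a) * (s / r) = r * s" using r by (simp flip: r(2))
  moreover have "- 1 \<le> s / r \<longleftrightarrow> - r \<le> s" using r(1) by (simp add: field_simps)
  ultimately show ?thesis by (auto simp: shifted_exponential_eq indicator_def)
qed

lemma ex_centered_log_concave_ray_less:
  assumes a: "exp (- real DIM('a::euclidean_space)) < a"
  shows "\<exists>(f :: 'a \<Rightarrow> real) \<theta>. centered_log_concave f \<and> norm \<theta> = 1 \<and>
    (\<integral>\<^sup>+s\<in>{0..}. ennreal (f (s *\<^sub>R \<theta>)) \<partial>lebesgue)
      < ennreal a * (\<integral>\<^sup>+s. ennreal (f (s *\<^sub>R \<theta>)) \<partial>lebesgue)"
proof -
  define r where "r = sqrt (real DIM('a))"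
  have r: "0 < r" "r * r = real DIM('a)" by (auto simp: r_def)
  define \<theta> where "\<theta> = (1 / r) *\<^sub>R (\<Sum>Basis :: 'a)"
  have "b \<bullet> (\<Sum>Basis) = 1" if "b \<in> Basis" for b :: 'a
    using that by (simp add: inner_sum_right inner_Basis)
  then have "norm (\<Sum>Basis :: 'a) = r" by (simp add: r_def norm_eq_sqrt_inner inner_sum_left)
  then have \<theta>: "norm \<theta> = 1" using r by (simp add: \<theta>_def)
  have diag: "shifted_exponential (s *\<^sub>R \<theta>) = indicator {- r..} s * exp (- (r * s))" for s
    unfolding \<theta>_def r_def by (rule shifted_exponential_diagonal)
  have "(\<integral>\<^sup>+s\<in>{0..}. ennreal (shifted_exponential (s *\<^sub>R \<theta>)) \<partial>lebesgue)
      = (\<integral>\<^sup>+s\<in>{0..}. ennreal (exp (- (r * s))) \<partial>lborel)"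
    unfolding nn_integral_completion using r by (intro nn_integral_cong) (auto simp: diag indicator_def)
  then have 1: "(\<integral>\<^sup>+s\<in>{0..}. ennreal (shifted_exponential (s *\<^sub>R \<theta>)) \<partial>lebesgue) = ennreal (1 / r)"
    using r by (simp add: nn_integral_exp_atLeast)
  have "(\<integral>\<^sup>+s. ennreal (shifted_exponential (s *\<^sub>R \<theta>)) \<partial>lebesgue)
      = (\<integral>\<^sup>+s\<in>{- r..}. ennreal (exp (- (r * s))) \<partial>lborel)"
    unfolding nn_integral_completion by (intro nn_integral_cong) (auto simp: diag indicator_def)
  then have 2: "(\<integral>\<^sup>+s. ennreal (shifted_exponential (s *\<^sub>R \<theta>)) \<partial>lebesgue) = ennreal (exp (real DIM('a)) / r)"
    using r by (simp add: nn_integral_exp_atLeast)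
  have a0: "0 < a" using a exp_gt_zero less_trans by blast
  have "exp (- real DIM('a)) * exp (real DIM('a)) < a * exp (real DIM('a))"
    using a by (intro mult_strict_right_mono) auto
  then have "1 / r < a * (exp (real DIM('a)) / r)" using r by (simp add: divide_simps flip: exp_add)
  then have "ennreal (1 / r) < ennreal a * ennreal (exp (real DIM('a)) / r)"
    using a0 r by (simp add: ennreal_lessI flip: ennreal_mult')
  then show ?thesis
    using centered_log_concave_shifted_exponential \<theta> 1 2 by (intro exI[of _ shifted_exponential] exI[of _ \<theta>]) simp
qed

section \<open>The sharp inequality for sections\<close>

theorem mainTheorem1:
  "(\<forall>(f :: real ^ 'n \<Rightarrow> real) (\<theta> :: real ^ 'n).
      centered_log_concave f \<longrightarrow> \<theta> \<in> sphere 0 1 \<longrightarrow>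
      (\<integral>\<^sup>+s\<in>{0..}. ennreal (f (s *\<^sub>R \<theta>)) \<partial>(lebesgue :: real measure))
        \<ge> ennreal (exp (- real CARD('n))) * (\<integral>\<^sup>+s. ennreal (f (s *\<^sub>R \<theta>)) \<partial>(lebesgue :: real measure)))
   \<and>
   (\<forall>a :: real. a > exp (- real CARD('n)) \<longrightarrow>
      (\<exists>(f :: real ^ 'n \<Rightarrow> real) (\<theta> :: real ^ 'n).
        centered_log_concave f \<and> \<theta> \<in> sphere 0 1 \<and>
        (\<integral>\<^sup>+s\<in>{0..}. ennreal (f (s *\<^sub>R \<theta>)) \<partial>(lebesgue :: real measure))
          < ennreal a * (\<integral>\<^sup>+s. ennreal (f (s *\<^sub>R \<theta>)) \<partial>(lebesgue :: real measure))))"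
proof (intro conjI allI impI)
  fix f :: "real ^ 'n \<Rightarrow> real" and \<theta> :: "real ^ 'n"
  assume "centered_log_concave f" "\<theta> \<in> sphere 0 1"
  then show "ennreal (exp (- real CARD('n))) * (\<integral>\<^sup>+s. ennreal (f (s *\<^sub>R \<theta>)) \<partial>lebesgue)
      \<le> (\<integral>\<^sup>+s\<in>{0..}. ennreal (f (s *\<^sub>R \<theta>)) \<partial>lebesgue)"
    using centered_log_concave_ray_ge[of f \<theta>] by simp
next
  fix a :: real
  assume "exp (- real CARD('n)) < a"
  then show "\<exists>(f :: real ^ 'n \<Rightarrow> real) \<theta>. centered_log_concave f \<and> \<theta> \<in> sphere 0 1 \<and>
      (\<integral>\<^sup>+s\<in>{0..}. ennreal (f (s *\<^sub>R \<theta>)) \<partial>lebesgue)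
        < ennreal a * (\<integral>\<^sup>+s. ennreal (f (s *\<^sub>R \<theta>)) \<partial>lebesgue)"
    using ex_centered_log_concave_ray_less[where 'a="real ^ 'n", of a] by simp
qed

end
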